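(* Let $F$ be a field of characteristic $0$, let $L$ be a finite-dimensional simple anti-commutative algebra over $F$ with product $[\cdot,\cdot]$, and let $\Delta:L\to L\otimes L$ be a comultiplication such that $(L,\Delta)$ is an anti-commutative bialgebra whose Drinfeld double $D(L)$ is semisimple and not simple, so that $D(L)=L_1\oplus L_2$ with simple ideals $L_1,L_2$. Let $\phi_1,\phi_2:L^*\to L$ be the linear maps determined by $f-\phi_i(f)\in L_i$ for all $f\in L^*$, let $\psi:L\to L^*$ be the linear isomorphism determined by $a=-\phi_1(\psi(a))+\phi_2(\psi(a))$ for all $a\in L$, and let $R:L\to L$ be the operator $R(a)=\phi_1(\psi(a))$ (a Rota-Baxter operator of weight $1$). Then there are a non skew-symmetric solution $r=\sum_i a_i\otimes b_i\in L\otimes L$ of the classical Yang-Baxter equation on $L$ such that $r+\tau(r)$ is $L$-invariant, and a non-degenerate associative symmetric bilinear form $\omega$ on $L$, such that for all $a\in L$ $$R(a)=\sum_i\omega(a_i,a)\,b_i.$$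
   Context: Algebras are not assumed associative or unital. An algebra is simple if its product is not identically zero and it has no two-sided ideals other than $0$ and itself; it is called semisimple if it is a direct sum of simple ideals. An algebra is anti-commutative if $[x,y]=-[y,x]$ for all $x,y$. A comultiplication on $L$ is a linear map $\Delta:L\to L\otimes L$; write $\Delta(a)=\sum a_{(1)}\otimes a_{(2)}$. The dual space $L^*$ is an algebra with product $(fg)(a)=\sum f(a_{(1)})g(a_{(2)})$. For $a,b\in L$ and $f\in L^*$ put $$f\rightharpoonup a=\sum a_{(1)}f(a_{(2)})\in L,\qquad a\leftharpoonup f=\sum f(a_{(1)})a_{(2)}\in L,$$ and define $f\leftharpoondown a\in L^*$ and $b\rightharpoondown f\in L^*$ by $$(f\leftharpoondown a)(b)=f([a,b]),\qquad (b\rightharpoondown f)(a)=f([a,b]).$$ The Drinfeld double of $(L,\Delta)$ is the vector space $D(L)=L\oplus L^*$ with the multiplication $$(a+f)(b+g)=([a,b]+f\rightharpoonup b+a\leftharpoonup g)+(fg+f\leftharpoondown b+a\rightharpoondown g),\quad a,b\in L,\ f,g\in L^*.$$ $(L,\Delta)$ is an anti-commutative bialgebra if $D(L)$ is an anti-commutative algebra. It is known that for simple $L$ every proper nonzero ideal of $D(L)$ has dimension $\dim L$; hence a semisimple non-simple $D(L)$ is a direct sum of exactly two simple ideals $L_1,L_2$, each of dimension $\dim L$. For each $f\in L^*$ there is a unique $\phi_i(f)\in L$ with $f-\phi_i(f)\in L_i$ ($i=1,2$), and for each $a\in L$ there is a unique $f\in L^*$ with $a=-\phi_1(f)+\phi_2(f)$;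 this $f$ is $\psi(a)$. $\tau:L\otimes L\to L\otimes L$ is the linear switch map $\tau(x\otimes y)=y\otimes x$. An element $r$ is skew-symmetric if $\tau(r)=-r$; non skew-symmetric means $\tau(r)\ne -r$. An element $r=\sum_i a_i\otimes b_i$ is a solution of the classical Yang-Baxter equation on $L$ if $$\sum_{i,j}\Big([a_i,a_j]\otimes b_i\otimes b_j-a_i\otimes[a_j,b_i]\otimes b_j+a_i\otimes a_j\otimes[b_i,b_j]\Big)=0.$$ An element $u=\sum_i u_i\otimes v_i\in L\otimes L$ is $L$-invariant if $\sum_i\big([u_i,a]\otimes v_i+u_i\otimes[v_i,a]\big)=0$ for all $a\in L$. A bilinear form $\omega$ on $L$ is associative if $\omega([x,y],z)=\omega(x,[y,z])$ for all $x,y,z\in L$. A linear operator $R:L\to L$ is a Rota-Baxter operator of weight $\lambda\in F$ if $[R(x),R(y)]=R([R(x),y]+[x,R(y)]+\lambda[x,y])$ for all $x,y\in L$. *)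

theory Defs
  imports Complex_Main "HOL-Library.Function_Algebras" "HOL-Library.Product_Plus"
begin

(* An algebra is given by a scalar multiplication s, a carrier V (a subspace of the
   underlying type) and a product m; no associativity or unit is required. *)

definition bilinear_map ::
    "('f::field \<Rightarrow> 'v::ab_group_add \<Rightarrow> 'v) \<Rightarrow> ('f \<Rightarrow> 'w::ab_group_add \<Rightarrow> 'w) \<Rightarrow>
      ('v \<Rightarrow> 'v \<Rightarrow> 'w) \<Rightarrow> bool" where
  "bilinear_map s s' \<beta> \<longleftrightarrow>
     (\<forall>x. Vector_Spaces.linear s s' (\<lambda>y. \<beta> x y)) \<and>
     (\<forall>y. Vector_Spaces.linear s s' (\<lambda>x. \<beta> x y))"

definition anticommutative :: "'v::ab_group_add set \<Rightarrow> ('v \<Rightarrow> 'v \<Rightarrow> 'v) \<Rightarrow> bool" where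
  "anticommutative V m \<longleftrightarrow> (\<forall>x\<in>V. \<forall>y\<in>V. m x y = - m y x)"

definition two_sided_ideal ::
    "('f::field \<Rightarrow> 'v::ab_group_add \<Rightarrow> 'v) \<Rightarrow> 'v set \<Rightarrow> ('v \<Rightarrow> 'v \<Rightarrow> 'v) \<Rightarrow> 'v set \<Rightarrow> bool" where
  "two_sided_ideal s V m I \<longleftrightarrow>
     I \<subseteq> V \<and> module.subspace s I \<and> (\<forall>x\<in>V. \<forall>y\<in>I. m x y \<in> I \<and> m y x \<in> I)"

definition simple_algebra ::
    "('f::field \<Rightarrow> 'v::ab_group_add \<Rightarrow> 'v) \<Rightarrow> 'v set \<Rightarrow> ('v \<Rightarrow> 'v \<Rightarrow> 'v) \<Rightarrow> bool" where
  "simple_algebra s V m \<longleftrightarrow>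
     (\<exists>x\<in>V. \<exists>y\<in>V. m x y \<noteq> 0) \<and> (\<forall>I. two_sided_ideal s V m I \<longrightarrow> I = {0} \<or> I = V)"

definition simple_ideal ::
    "('f::field \<Rightarrow> 'v::ab_group_add \<Rightarrow> 'v) \<Rightarrow> 'v set \<Rightarrow> ('v \<Rightarrow> 'v \<Rightarrow> 'v) \<Rightarrow> 'v set \<Rightarrow> bool" where
  "simple_ideal s V m I \<longleftrightarrow> two_sided_ideal s V m I \<and> simple_algebra s I m"

definition internal_direct_sum :: "'v::ab_group_add set set \<Rightarrow> 'v set \<Rightarrow> bool" where
  "internal_direct_sum \<I> V \<longleftrightarrow>
     V = {\<Sum>I\<in>\<I>. c I | c. \<forall>I\<in>\<I>. c I \<in> I} \<and>
     (\<forall>c. (\<forall>I\<in>\<I>. c I \<in> I) \<and> (\<Sum>I\<in>\<I>. c I) = 0 \<longrightarrow> (\<forall>I\<in>\<I>. c I = 0))"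

definition semisimple_algebra ::
    "('f::field \<Rightarrow> 'v::ab_group_add \<Rightarrow> 'v) \<Rightarrow> 'v set \<Rightarrow> ('v \<Rightarrow> 'v \<Rightarrow> 'v) \<Rightarrow> bool" where
  "semisimple_algebra s V m \<longleftrightarrow>
     (\<exists>\<I>. finite \<I> \<and> (\<forall>I\<in>\<I>. simple_ideal s V m I) \<and> internal_direct_sum \<I> V)"


definition fun_scale :: "'f::field \<Rightarrow> ('b \<Rightarrow> 'f) \<Rightarrow> 'b \<Rightarrow> 'f" where
  "fun_scale c f = (\<lambda>x. c * f x)"

definition dual :: "('f::field \<Rightarrow> 'v::ab_group_add \<Rightarrow> 'v) \<Rightarrow> ('v \<Rightarrow> 'f) set" where
  "dual s = {f. Vector_Spaces.linear s (*) f}"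


(* The tensor square of a vector space is realised as the span of the pure tensors inside
   the dual of the space of bilinear forms, x \<otimes> y being evaluation at (x, y); it is set to 0
   off the bilinear forms so that equality of tensors is equality of functions.
   Lemma tensor_lift_unique below is its universal property. *)

type_synonym ('f, 'v) tensor = "('v \<Rightarrow> 'v \<Rightarrow> 'f) \<Rightarrow> 'f"

definition pure_tensor ::
    "('f::field \<Rightarrow> 'v::ab_group_add \<Rightarrow> 'v) \<Rightarrow> 'v \<Rightarrow> 'v \<Rightarrow> ('f, 'v) tensor" where
  "pure_tensor s x y = (\<lambda>\<beta>. if bilinear_map s (*) \<beta> then \<beta> x y else 0)"

definition tensor_square ::
    "('f::field \<Rightarrow> 'v::ab_group_add \<Rightarrow> 'v) \<Rightarrow> ('f, 'v) tensor set" where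
  "tensor_square s = module.span fun_scale {pure_tensor s x y | x y. True}"

definition tensor_sum ::
    "('f::field \<Rightarrow> 'v::ab_group_add \<Rightarrow> 'v) \<Rightarrow> ('v \<times> 'v) list \<Rightarrow> ('f, 'v) tensor" where
  "tensor_sum s ab = (\<Sum>(x, y)\<leftarrow>ab. pure_tensor s x y)"

(* For bilinear \<beta>, the value at t = x1 \<otimes> y1 + ... + xn \<otimes> yn of the linear map induced by \<beta>,
   i.e. \<beta> x1 y1 + ... + \<beta> xn yn. *)

definition tensor_lift ::
    "('f::field \<Rightarrow> 'v::ab_group_add \<Rightarrow> 'v) \<Rightarrow> ('v \<Rightarrow> 'v \<Rightarrow> 'w::ab_group_add) \<Rightarrow>
      ('f, 'v) tensor \<Rightarrow> 'w" where
  "tensor_lift s \<beta> t = (THE w. \<exists>ab. t = tensor_sum s ab \<and> w = (\<Sum>(x, y)\<leftarrow>ab. \<beta> x y))"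

definition trilinear_form ::
    "('f::field \<Rightarrow> 'v::ab_group_add \<Rightarrow> 'v) \<Rightarrow> ('v \<Rightarrow> 'v \<Rightarrow> 'v \<Rightarrow> 'f) \<Rightarrow> bool" where
  "trilinear_form s \<beta> \<longleftrightarrow>
     (\<forall>y z. Vector_Spaces.linear s (*) (\<lambda>x. \<beta> x y z)) \<and>
     (\<forall>x z. Vector_Spaces.linear s (*) (\<lambda>y. \<beta> x y z)) \<and>
     (\<forall>x y. Vector_Spaces.linear s (*) (\<lambda>z. \<beta> x y z))"

definition pure_tensor3 ::
    "('f::field \<Rightarrow> 'v::ab_group_add \<Rightarrow> 'v) \<Rightarrow> 'v \<Rightarrow> 'v \<Rightarrow> 'v \<Rightarrow> ('v \<Rightarrow> 'v \<Rightarrow> 'v \<Rightarrow> 'f) \<Rightarrow> 'f" where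
  "pure_tensor3 s x y z = (\<lambda>\<beta>. if trilinear_form s \<beta> then \<beta> x y z else 0)"

lemma vector_space_fun_scale: "vector_space (fun_scale :: 'f::field \<Rightarrow> ('b \<Rightarrow> 'f) \<Rightarrow> 'b \<Rightarrow> 'f)"
  by unfold_locales (auto simp: fun_scale_def fun_eq_iff algebra_simps)

lemma vector_space_field: "vector_space ((*) :: 'f::field \<Rightarrow> 'f \<Rightarrow> 'f)"
  by unfold_locales (auto simp: algebra_simps)

lemma tensor_sum_append: "tensor_sum s (ab @ cd) = tensor_sum s ab + tensor_sum s cd"
  by (simp add: tensor_sum_def)

lemma tensor_sum_Nil: "tensor_sum s [] = 0"
  by (simp add: tensor_sum_def)

lemma tensor_sum_Cons: "tensor_sum s (p # ab) = pure_tensor s (fst p) (snd p) + tensor_sum s ab"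
  by (simp only: tensor_sum_def list.map sum_list.Cons case_prod_unfold)

lemma tensor_sum_single: "tensor_sum s [(x, y)] = pure_tensor s x y"
  by (simp only: tensor_sum_Cons tensor_sum_Nil add_0_right fst_conv snd_conv)

lemma tensor_sum_apply:
  assumes "bilinear_map s (*) \<beta>"
  shows "tensor_sum s ab \<beta> = (\<Sum>(x, y)\<leftarrow>ab. \<beta> x y)"
  using assms by (induction ab) (auto simp: tensor_sum_def pure_tensor_def)

lemma bilinear_map_scale_left:
  assumes "bilinear_map s s' \<beta>"
  shows "\<beta> (s c x) y = s' c (\<beta> x y)"
proof -
  interpret Vector_Spaces.linear s s' "\<lambda>x. \<beta> x y"
    using assms by (simp add: bilinear_map_def)
  show ?thesis by (rule scale)
qed

lemma fun_scale_tensor_sum: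
  "fun_scale c (tensor_sum s ab) = tensor_sum s (map (\<lambda>(x, y). (s c x, y)) ab)"
proof -
  have "fun_scale c (pure_tensor s x y) = pure_tensor s (s c x) y" for x y
    unfolding fun_scale_def pure_tensor_def
    by (rule ext) (simp add: bilinear_map_scale_left[where s = s and s' = "(*)"])
  then show ?thesis
    by (induction ab)
      (auto simp: tensor_sum_def fun_eq_iff fun_scale_def algebra_simps)
qed

lemma tensor_square_eq:
  fixes s :: "'f::field \<Rightarrow> 'v::ab_group_add \<Rightarrow> 'v"
  shows "tensor_square s = range (tensor_sum s)"
proof -
  interpret W: vector_space "fun_scale :: 'f \<Rightarrow> ('f, 'v) tensor \<Rightarrow> ('f, 'v) tensor"
    by (rule vector_space_fun_scale)
  have "W.subspace (range (tensor_sum s))"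
    unfolding W.subspace_def
  proof (intro conjI ballI allI)
    show "0 \<in> range (tensor_sum s)" by (rule range_eqI) (rule tensor_sum_Nil[symmetric])
  next
    fix t u assume "t \<in> range (tensor_sum s)" "u \<in> range (tensor_sum s)"
    then obtain ab cd where "t = tensor_sum s ab" "u = tensor_sum s cd" by blast
    then have "t + u = tensor_sum s (ab @ cd)" by (simp only: tensor_sum_append)
    then show "t + u \<in> range (tensor_sum s)" by (rule range_eqI)
  next
    fix c t assume "t \<in> range (tensor_sum s)"
    then obtain ab where "t = tensor_sum s ab" by blast
    then show "fun_scale c t \<in> range (tensor_sum s)"
      by (simp only: fun_scale_tensor_sum rangeI)
  qed
  moreover have "{pure_tensor s x y | x y. True} \<subseteq> range (tensor_sum s)"
  proof
    fix t assume "t \<in> {pure_tensor s x y | x y. True}"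
    then obtain x y where "t = pure_tensor s x y" by blast
    then have "t = tensor_sum s [(x, y)]" by (simp only: tensor_sum_single)
    then show "t \<in> range (tensor_sum s)" by (rule range_eqI)
  qed
  ultimately have "tensor_square s \<subseteq> range (tensor_sum s)"
    unfolding tensor_square_def by (intro W.span_minimal)
  moreover have "tensor_sum s ab \<in> tensor_square s" for ab
  proof (induction ab)
    case Nil
    show ?case unfolding tensor_square_def tensor_sum_Nil by (rule W.span_zero)
  next
    case (Cons p ab)
    have "pure_tensor s (fst p) (snd p) \<in> tensor_square s"
      unfolding tensor_square_def by (rule W.span_base) blast
    then have "pure_tensor s (fst p) (snd p) + tensor_sum s ab \<in> tensor_square s"
      using Cons unfolding tensor_square_def by (rule W.span_add)
    then show ?case by (simp only: tensor_sum_Cons)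
  qed
  ultimately show ?thesis by (intro equalityI image_subsetI)
qed

lemma tensor_lift_tensor_sum:
  fixes s :: "'f::field \<Rightarrow> 'v::ab_group_add \<Rightarrow> 'v"
    and s' :: "'f \<Rightarrow> 'w::ab_group_add \<Rightarrow> 'w"
  assumes \<beta>: "bilinear_map s s' \<beta>"
  shows "tensor_lift s \<beta> (tensor_sum s ab) = (\<Sum>(x, y)\<leftarrow>ab. \<beta> x y)"
proof -
  have lin: "Vector_Spaces.linear s s' (\<beta> 0)"
    using \<beta> by (simp add: bilinear_map_def)
  interpret W: vector_space s'
    using lin by (rule Vector_Spaces.linear.axioms)
  interpret P: vector_space_pair s' "(*) :: 'f \<Rightarrow> 'f \<Rightarrow> 'f"
    by (simp add: vector_space_pair_def W.vector_space_axioms vector_space_field)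
  have wd: "(\<Sum>(x, y)\<leftarrow>ab. \<beta> x y) = (\<Sum>(x, y)\<leftarrow>cd. \<beta> x y)"
    if eq: "tensor_sum s ab = tensor_sum s cd" for ab cd
  proof (rule ccontr)
    define w where "w = (\<Sum>(x, y)\<leftarrow>ab. \<beta> x y) - (\<Sum>(x, y)\<leftarrow>cd. \<beta> x y)"
    assume "(\<Sum>(x, y)\<leftarrow>ab. \<beta> x y) \<noteq> (\<Sum>(x, y)\<leftarrow>cd. \<beta> x y)"
    then have "w \<noteq> 0" unfolding w_def by simp
    then have "\<not> W.dependent {w}" by (simp only: W.dependent_single not_False_eq_True)
    from P.linear_independent_extend[OF this, of "\<lambda>_. 1"]
    obtain g where g: "Vector_Spaces.linear s' (*) g" and gw: "g w = 1" by blast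
    interpret g: Vector_Spaces.linear s' "(*)" g by (rule g)
    have bil: "bilinear_map s (*) (\<lambda>x y. g (\<beta> x y))"
      unfolding bilinear_map_def
    proof (intro conjI allI)
      fix x
      have "Vector_Spaces.linear s s' (\<lambda>y. \<beta> x y)"
        using \<beta> by (simp add: bilinear_map_def)
      from Vector_Spaces.linear_compose[OF this g]
      show "Vector_Spaces.linear s (*) (\<lambda>y. g (\<beta> x y))" by (simp add: o_def)
    next
      fix y
      have "Vector_Spaces.linear s s' (\<lambda>x. \<beta> x y)"
        using \<beta> by (simp add: bilinear_map_def)
      from Vector_Spaces.linear_compose[OF this g]
      show "Vector_Spaces.linear s (*) (\<lambda>x. g (\<beta> x y))" by (simp add: o_def)
    qed
    have gsum: "g (\<Sum>(x, y)\<leftarrow>l. \<beta> x y) = tensor_sum s l (\<lambda>x y. g (\<beta> x y))" for l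
      unfolding tensor_sum_apply[OF bil]
      by (induction l) (simp_all add: g.add g.zero case_prod_unfold)
    have "g w = 0" unfolding w_def g.diff gsum eq by simp
    with gw show False by simp
  qed
  show ?thesis
    unfolding tensor_lift_def
  proof (rule the_equality)
    show "\<exists>cd. tensor_sum s ab = tensor_sum s cd \<and> (\<Sum>(x, y)\<leftarrow>ab. \<beta> x y) = (\<Sum>(x, y)\<leftarrow>cd. \<beta> x y)"
      by (intro exI[of _ ab]) simp
  next
    fix w
    assume "\<exists>cd. tensor_sum s ab = tensor_sum s cd \<and> w = (\<Sum>(x, y)\<leftarrow>cd. \<beta> x y)"
    then obtain cd where cd: "tensor_sum s ab = tensor_sum s cd" "w = (\<Sum>(x, y)\<leftarrow>cd. \<beta> x y)"
      by auto
    show "w = (\<Sum>(x, y)\<leftarrow>ab. \<beta> x y)" unfolding cd(2) by (rule wd[OF cd(1), symmetric])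
  qed
qed

lemma tensor_lift_unique:
  fixes s :: "'f::field \<Rightarrow> 'v::ab_group_add \<Rightarrow> 'v"
    and s' :: "'f \<Rightarrow> 'w::ab_group_add \<Rightarrow> 'w"
  assumes \<beta>: "bilinear_map s s' \<beta>"
  shows "tensor_lift s \<beta> (pure_tensor s x y) = \<beta> x y"
    and "\<lbrakk>t \<in> tensor_square s; u \<in> tensor_square s\<rbrakk> \<Longrightarrow>
      tensor_lift s \<beta> (t + u) = tensor_lift s \<beta> t + tensor_lift s \<beta> u"
    and "t \<in> tensor_square s \<Longrightarrow> tensor_lift s \<beta> (fun_scale c t) = s' c (tensor_lift s \<beta> t)"
    and "\<lbrakk>\<And>x y. h (pure_tensor s x y) = \<beta> x y;
      \<And>t u. \<lbrakk>t \<in> tensor_square s; u \<in> tensor_square s\<rbrakk> \<Longrightarrow> h (t + u) = h t + h u;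
      t \<in> tensor_square s\<rbrakk> \<Longrightarrow> h t = tensor_lift s \<beta> t"
proof -
  have lin: "Vector_Spaces.linear s s' (\<beta> 0)"
    using \<beta> by (simp add: bilinear_map_def)
  interpret W: vector_space s'
    using lin by (rule Vector_Spaces.linear.axioms)
  note L = tensor_lift_tensor_sum[OF \<beta>]
  show "tensor_lift s \<beta> (pure_tensor s x y) = \<beta> x y"
    using L[of "[(x, y)]"] unfolding tensor_sum_single by simp
  show "tensor_lift s \<beta> (t + u) = tensor_lift s \<beta> t + tensor_lift s \<beta> u"
    if t: "t \<in> tensor_square s" and u: "u \<in> tensor_square s"
  proof -
    obtain ab where ab: "t = tensor_sum s ab" using t unfolding tensor_square_eq by blast
    obtain cd where cd: "u = tensor_sum s cd" using u unfolding tensor_square_eq by blast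
    have "tensor_lift s \<beta> (t + u) = tensor_lift s \<beta> (tensor_sum s (ab @ cd))"
      by (simp only: ab cd tensor_sum_append)
    also have "\<dots> = tensor_lift s \<beta> t + tensor_lift s \<beta> u"
      unfolding L ab cd by simp
    finally show ?thesis .
  qed
  show "tensor_lift s \<beta> (fun_scale c t) = s' c (tensor_lift s \<beta> t)"
    if t: "t \<in> tensor_square s"
  proof -
    have "(\<Sum>(x, y)\<leftarrow>map (\<lambda>(x, y). (s c x, y)) ab. \<beta> x y) = s' c (\<Sum>(x, y)\<leftarrow>ab. \<beta> x y)" for ab
      by (induction ab)
        (simp_all add: case_prod_unfold bilinear_map_scale_left[OF \<beta>] W.scale_right_distrib)
    moreover obtain ab where ab: "t = tensor_sum s ab"
      using t unfolding tensor_square_eq by blast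
    ultimately show ?thesis unfolding ab fun_scale_tensor_sum L by simp
  qed
  show "h t = tensor_lift s \<beta> t"
    if pure: "\<And>x y. h (pure_tensor s x y) = \<beta> x y"
      and add: "\<And>t u. \<lbrakk>t \<in> tensor_square s; u \<in> tensor_square s\<rbrakk> \<Longrightarrow> h (t + u) = h t + h u"
      and t: "t \<in> tensor_square s"
  proof -
    have mem: "tensor_sum s ab \<in> tensor_square s" for ab
      by (simp add: tensor_square_eq)
    have pmem: "pure_tensor s x y \<in> tensor_square s" for x y
      using mem[of "[(x, y)]"] by (simp only: tensor_sum_single)
    have h0: "h 0 = 0"
      using add[OF mem[of "[]"] mem[of "[]"]] unfolding tensor_sum_Nil by simp
    have "h (tensor_sum s ab) = (\<Sum>(x, y)\<leftarrow>ab. \<beta> x y)" for ab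
    proof (induction ab)
      case Nil
      show ?case unfolding tensor_sum_Nil h0 by simp
    next
      case (Cons p ab)
      have "h (tensor_sum s (p # ab)) = \<beta> (fst p) (snd p) + h (tensor_sum s ab)"
        unfolding tensor_sum_Cons add[OF pmem mem] pure ..
      then show ?case using Cons by (simp add: case_prod_unfold)
    qed
    moreover obtain ab where ab: "t = tensor_sum s ab"
      using t unfolding tensor_square_eq by blast
    ultimately show ?thesis unfolding ab L by simp
  qed
qed


definition comultiplication ::
    "('f::field \<Rightarrow> 'v::ab_group_add \<Rightarrow> 'v) \<Rightarrow> ('v \<Rightarrow> ('f, 'v) tensor) \<Rightarrow> bool" where
  "comultiplication s \<Delta> \<longleftrightarrow>
     Vector_Spaces.linear s fun_scale \<Delta> \<and> (\<forall>a. \<Delta> a \<in> tensor_square s)"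

definition dual_mult ::
    "('f::field \<Rightarrow> 'v::ab_group_add \<Rightarrow> 'v) \<Rightarrow> ('v \<Rightarrow> ('f, 'v) tensor) \<Rightarrow>
      ('v \<Rightarrow> 'f) \<Rightarrow> ('v \<Rightarrow> 'f) \<Rightarrow> 'v \<Rightarrow> 'f" where
  "dual_mult s \<Delta> f g = (\<lambda>a. tensor_lift s (\<lambda>x y. f x * g y) (\<Delta> a))"

definition left_harpoon ::
    "('f::field \<Rightarrow> 'v::ab_group_add \<Rightarrow> 'v) \<Rightarrow> ('v \<Rightarrow> ('f, 'v) tensor) \<Rightarrow> ('v \<Rightarrow> 'f) \<Rightarrow> 'v \<Rightarrow> 'v" where
  "left_harpoon s \<Delta> f a = tensor_lift s (\<lambda>x y. s (f y) x) (\<Delta> a)"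

definition right_harpoon ::
    "('f::field \<Rightarrow> 'v::ab_group_add \<Rightarrow> 'v) \<Rightarrow> ('v \<Rightarrow> ('f, 'v) tensor) \<Rightarrow> 'v \<Rightarrow> ('v \<Rightarrow> 'f) \<Rightarrow> 'v" where
  "right_harpoon s \<Delta> a f = tensor_lift s (\<lambda>x y. s (f x) y) (\<Delta> a)"

(* The pair (a, f) stands for a + f. The two summands \<lambda>x. f (br b x) and \<lambda>x. g (br x a) are the
   right action of b on f and the left action of a on g. *)

definition double_mult ::
    "('f::field \<Rightarrow> 'v::ab_group_add \<Rightarrow> 'v) \<Rightarrow> ('v \<Rightarrow> 'v \<Rightarrow> 'v) \<Rightarrow> ('v \<Rightarrow> ('f, 'v) tensor) \<Rightarrow>
      'v \<times> ('v \<Rightarrow> 'f) \<Rightarrow> 'v \<times> ('v \<Rightarrow> 'f) \<Rightarrow> 'v \<times> ('v \<Rightarrow> 'f)" where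
  "double_mult s br \<Delta> = (\<lambda>(a, f) (b, g).
     (br a b + left_harpoon s \<Delta> f b + right_harpoon s \<Delta> a g,
      dual_mult s \<Delta> f g + (\<lambda>x. f (br b x)) + (\<lambda>x. g (br x a))))"

definition double_carrier ::
    "('f::field \<Rightarrow> 'v::ab_group_add \<Rightarrow> 'v) \<Rightarrow> ('v \<times> ('v \<Rightarrow> 'f)) set" where
  "double_carrier s = UNIV \<times> dual s"

definition double_scale ::
    "('f::field \<Rightarrow> 'v::ab_group_add \<Rightarrow> 'v) \<Rightarrow> 'f \<Rightarrow> 'v \<times> ('v \<Rightarrow> 'f) \<Rightarrow> 'v \<times> ('v \<Rightarrow> 'f)" where
  "double_scale s c = (\<lambda>(a, f). (s c a, fun_scale c f))"

definition anticommutative_bialgebra ::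
    "('f::field \<Rightarrow> 'v::ab_group_add \<Rightarrow> 'v) \<Rightarrow> ('v \<Rightarrow> 'v \<Rightarrow> 'v) \<Rightarrow> ('v \<Rightarrow> ('f, 'v) tensor) \<Rightarrow> bool" where
  "anticommutative_bialgebra s br \<Delta> \<longleftrightarrow>
     comultiplication s \<Delta> \<and> anticommutative (double_carrier s) (double_mult s br \<Delta>)"

definition phi :: "('v::ab_group_add \<times> ('v \<Rightarrow> 'f::field)) set \<Rightarrow> ('v \<Rightarrow> 'f) \<Rightarrow> 'v" where
  "phi I f = (THE a. (0, f) - (a, 0) \<in> I)"

definition psi ::
    "('f::field \<Rightarrow> 'v::ab_group_add \<Rightarrow> 'v) \<Rightarrow> ('v \<times> ('v \<Rightarrow> 'f)) set \<Rightarrow>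
      ('v \<times> ('v \<Rightarrow> 'f)) set \<Rightarrow> 'v \<Rightarrow> 'v \<Rightarrow> 'f" where
  "psi s L1 L2 a = (THE f. f \<in> dual s \<and> a = - phi L1 f + phi L2 f)"


definition tensor_switch ::
    "('f::field \<Rightarrow> 'v::ab_group_add \<Rightarrow> 'v) \<Rightarrow> ('f, 'v) tensor \<Rightarrow> ('f, 'v) tensor" where
  "tensor_switch s r = tensor_lift s (\<lambda>x y. pure_tensor s y x) r"

definition cybe_solution ::
    "('f::field \<Rightarrow> 'v::ab_group_add \<Rightarrow> 'v) \<Rightarrow> ('v \<Rightarrow> 'v \<Rightarrow> 'v) \<Rightarrow> ('f, 'v) tensor \<Rightarrow> bool" where
  "cybe_solution s br r \<longleftrightarrow>
     tensor_lift s (\<lambda>a b. tensor_lift s (\<lambda>a' b'.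
         pure_tensor3 s (br a a') b b'
       - pure_tensor3 s a (br a' b) b'
       + pure_tensor3 s a a' (br b b')) r) r = 0"

definition tensor_invariant ::
    "('f::field \<Rightarrow> 'v::ab_group_add \<Rightarrow> 'v) \<Rightarrow> ('v \<Rightarrow> 'v \<Rightarrow> 'v) \<Rightarrow> ('f, 'v) tensor \<Rightarrow> bool" where
  "tensor_invariant s br t \<longleftrightarrow>
     (\<forall>a. tensor_lift s (\<lambda>u v. pure_tensor s (br u a) v + pure_tensor s u (br v a)) t = 0)"

definition symmetric_form :: "('v \<Rightarrow> 'v \<Rightarrow> 'f) \<Rightarrow> bool" where
  "symmetric_form \<omega> \<longleftrightarrow> (\<forall>x y. \<omega> x y = \<omega> y x)"

definition associative_form :: "('v \<Rightarrow> 'v \<Rightarrow> 'v) \<Rightarrow> ('v \<Rightarrow> 'v \<Rightarrow> 'f) \<Rightarrow> bool" where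
  "associative_form br \<omega> \<longleftrightarrow> (\<forall>x y z. \<omega> (br x y) z = \<omega> x (br y z))"

definition nondegenerate_form :: "('v::zero \<Rightarrow> 'v \<Rightarrow> 'f::zero) \<Rightarrow> bool" where
  "nondegenerate_form \<omega> \<longleftrightarrow>
     (\<forall>x. (\<forall>y. \<omega> x y = 0) \<longrightarrow> x = 0) \<and> (\<forall>y. (\<forall>x. \<omega> x y = 0) \<longrightarrow> y = 0)"

end

(* The canonical form <a + f, b + g> = f(b) + g(a) on D(L) is associative, so the two simple ideals
   are orthogonal. Since L is simple, each L_i meets L either in 0 or in L, and the latter would force
   the other ideal, being orthogonal to L, to lie in L, hence to vanish. So the L_1-component of a in L
   has the form S a - R a with S : L -> L^* linear and injective, hence bijective; then S = psi and
   R = phi_1 psi.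

   The form omega(a, b) = (S a)(b) is symmetric with omega(R a, b) + omega(a, R b) + omega(a, b) = 0 by
   orthogonality of the L_1- and L_2-components, it is associative because the decomposition is compatible
   with multiplication by L, and R is Rota-Baxter of weight 1 because L_1 L_2 = 0 has L-part 0.

   For dual bases e_i, e^i of omega put r = sum_i e_i (x) R(e^i). Pairing tensors with products of the
   functionals omega(x, -) turns the Yang-Baxter equation into the Rota-Baxter identity, r + tau(r) into
   -omega (non-zero and invariant), and the formula for R into the expansion in a basis. *)

theory Submission
  imports Defs
begin

section \<open>Bilinear maps and tensors\<close>

lemma bilinear_mapI:
  assumes "vector_space s" "vector_space s'"
    and "\<And>x y z. \<beta> (x + y) z = \<beta> x z + \<beta> y z" "\<And>x y z. \<beta> x (y + z) = \<beta> x y + \<beta> x z"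
    and "\<And>c x y. \<beta> (s c x) y = s' c (\<beta> x y)" "\<And>c x y. \<beta> x (s c y) = s' c (\<beta> x y)"
  shows "bilinear_map s s' \<beta>"
  using assms by (simp add: bilinear_map_def Vector_Spaces.linear_iff)

lemma bilinear_mapD:
  assumes "bilinear_map s s' \<beta>"
  shows "\<beta> (x + y) z = \<beta> x z + \<beta> y z" "\<beta> x (y + z) = \<beta> x y + \<beta> x z"
    and "\<beta> (s c x) y = s' c (\<beta> x y)" "\<beta> x (s c y) = s' c (\<beta> x y)"
    and "\<beta> 0 y = 0" "\<beta> x 0 = 0" "\<beta> (- x) y = - \<beta> x y" "\<beta> x (- y) = - \<beta> x y"
    and "\<beta> (x - y) z = \<beta> x z - \<beta> y z" "\<beta> x (y - z) = \<beta> x y - \<beta> x z"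
    and "\<beta> (sum g A) y = (\<Sum>a\<in>A. \<beta> (g a) y)" "\<beta> x (sum g A) = (\<Sum>a\<in>A. \<beta> x (g a))"
proof -
  have L: "Vector_Spaces.linear s s' (\<lambda>y. \<beta> x y)" "Vector_Spaces.linear s s' (\<lambda>x. \<beta> x y)" for x y
    using assms by (auto simp: bilinear_map_def)
  interpret l: Vector_Spaces.linear s s' "\<lambda>y. \<beta> x y" for x by (rule L)
  interpret r: Vector_Spaces.linear s s' "\<lambda>x. \<beta> x y" for y by (rule L)
  show "\<beta> (x + y) z = \<beta> x z + \<beta> y z" "\<beta> x (y + z) = \<beta> x y + \<beta> x z"
    and "\<beta> (s c x) y = s' c (\<beta> x y)" "\<beta> x (s c y) = s' c (\<beta> x y)"
    and "\<beta> 0 y = 0" "\<beta> x 0 = 0" "\<beta> (- x) y = - \<beta> x y" "\<beta> x (- y) = - \<beta> x y"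
    and "\<beta> (x - y) z = \<beta> x z - \<beta> y z" "\<beta> x (y - z) = \<beta> x y - \<beta> x z"
    and "\<beta> (sum g A) y = (\<Sum>a\<in>A. \<beta> (g a) y)" "\<beta> x (sum g A) = (\<Sum>a\<in>A. \<beta> x (g a))"
    by (fact l.add r.add l.scale r.scale l.zero r.zero l.neg r.neg l.diff r.diff l.sum r.sum)+
qed

lemma trilinear_formD:
  assumes "trilinear_form s \<beta>"
  shows "\<beta> (x + x') y z = \<beta> x y z + \<beta> x' y z" "\<beta> x (y + y') z = \<beta> x y z + \<beta> x y' z"
    "\<beta> x y (z + z') = \<beta> x y z + \<beta> x y z'"
    and "\<beta> (s c x) y z = c * \<beta> x y z" "\<beta> x (s c y) z = c * \<beta> x y z" "\<beta> x y (s c z) = c * \<beta> x y z"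
    and "\<beta> (sum g A) y z = (\<Sum>a\<in>A. \<beta> (g a) y z)" "\<beta> x (sum g A) z = (\<Sum>a\<in>A. \<beta> x (g a) z)"
    "\<beta> x y (sum g A) = (\<Sum>a\<in>A. \<beta> x y (g a))"
proof -
  have L: "Vector_Spaces.linear s (*) (\<lambda>x. \<beta> x y z)" "Vector_Spaces.linear s (*) (\<lambda>y. \<beta> x y z)"
      "Vector_Spaces.linear s (*) (\<lambda>z. \<beta> x y z)" for x y z
    using assms by (auto simp: trilinear_form_def)
  interpret l1: Vector_Spaces.linear s "(*)" "\<lambda>x. \<beta> x y z" for y z by (rule L)
  interpret l2: Vector_Spaces.linear s "(*)" "\<lambda>y. \<beta> x y z" for x z by (rule L)
  interpret l3: Vector_Spaces.linear s "(*)" "\<lambda>z. \<beta> x y z" for x y by (rule L)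
  show "\<beta> (x + x') y z = \<beta> x y z + \<beta> x' y z" "\<beta> x (y + y') z = \<beta> x y z + \<beta> x y' z"
    "\<beta> x y (z + z') = \<beta> x y z + \<beta> x y z'"
    and "\<beta> (s c x) y z = c * \<beta> x y z" "\<beta> x (s c y) z = c * \<beta> x y z" "\<beta> x y (s c z) = c * \<beta> x y z"
    and "\<beta> (sum g A) y z = (\<Sum>a\<in>A. \<beta> (g a) y z)" "\<beta> x (sum g A) z = (\<Sum>a\<in>A. \<beta> x (g a) z)"
    "\<beta> x y (sum g A) = (\<Sum>a\<in>A. \<beta> x y (g a))"
    by (fact l1.add l2.add l3.add l1.scale l2.scale l3.scale l1.sum l2.sum l3.sum)+
qed

lemma sum_fun_apply: "(\<Sum>a\<in>A. F a) x = (\<Sum>a\<in>A. F a x)"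
  by (induction A rule: infinite_finite_induct) auto

context vector_space
begin

lemma bilinear_pure_tensor: "bilinear_map scale fun_scale (pure_tensor scale)"
  by (rule bilinear_mapI)
    (auto simp: vector_space_axioms vector_space_fun_scale pure_tensor_def fun_eq_iff fun_scale_def
      bilinear_mapD[where s = scale and s' = "(*)"])

lemma bilinear_pure_tensor_swap: "bilinear_map scale fun_scale (\<lambda>x y. pure_tensor scale y x)"
  by (rule bilinear_mapI)
    (auto simp: vector_space_axioms vector_space_fun_scale bilinear_mapD[OF bilinear_pure_tensor])

lemma pure_tensor3_linear:
  "pure_tensor3 scale (x + x') y z = pure_tensor3 scale x y z + pure_tensor3 scale x' y z"
  "pure_tensor3 scale x (y + y') z = pure_tensor3 scale x y z + pure_tensor3 scale x y' z"
  "pure_tensor3 scale x y (z + z') = pure_tensor3 scale x y z + pure_tensor3 scale x y z'"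
  "pure_tensor3 scale (scale c x) y z = fun_scale c (pure_tensor3 scale x y z)"
  "pure_tensor3 scale x (scale c y) z = fun_scale c (pure_tensor3 scale x y z)"
  "pure_tensor3 scale x y (scale c z) = fun_scale c (pure_tensor3 scale x y z)"
  by (auto simp: pure_tensor3_def fun_eq_iff fun_scale_def trilinear_formD)

lemma tensor_switch_tensor_sum:
  "tensor_switch scale (tensor_sum scale ab) = tensor_sum scale (map (\<lambda>(x, y). (y, x)) ab)"
  unfolding tensor_switch_def tensor_lift_tensor_sum[OF bilinear_pure_tensor_swap]
  by (simp add: tensor_sum_def o_def case_prod_unfold)

end

section \<open>The Yang--Baxter tensor of a Rota--Baxter operator\<close>

text \<open>This isolates what the double has to deliver: a Rota-Baxter operator of weight 1 whose
  \<omega>-adjoint is \<open>- R - id\<close>. Everything about the tensor \<open>r\<close> is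
  derived from these axioms, without reference to the double.\<close>

locale rota_baxter_form = finite_dimensional_vector_space scale Basis
  for scale :: "'f::field \<Rightarrow> 'v::ab_group_add \<Rightarrow> 'v" and Basis +
  fixes br :: "'v \<Rightarrow> 'v \<Rightarrow> 'v" and \<omega> :: "'v \<Rightarrow> 'v \<Rightarrow> 'f" and R :: "'v \<Rightarrow> 'v"
  assumes br_bilinear: "bilinear_map scale scale br"
    and br_anticommute: "br x y = - br y x"
    and form_bilinear: "bilinear_map scale (*) \<omega>"
    and form_sym: "\<omega> x y = \<omega> y x"
    and form_assoc: "\<omega> (br x y) z = \<omega> x (br y z)"
    and form_nondeg: "(\<And>y. \<omega> x y = 0) \<Longrightarrow> x = 0"
    and dual_represented: "f \<in> dual scale \<Longrightarrow> \<exists>x. f = \<omega> x"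
    and R_linear: "Vector_Spaces.linear scale scale R"
    and rota_baxter: "br (R x) (R y) = R (br (R x) y + br x (R y) + br x y)"
    and R_adjoint: "\<omega> (R x) y + \<omega> x (R y) + \<omega> x y = 0"
begin

sublocale R: Vector_Spaces.linear scale scale R
  by (rule R_linear)

lemmas br_simps = bilinear_mapD[OF br_bilinear]
lemmas form_simps = bilinear_mapD[OF form_bilinear]

section \<open>Dual bases of \<omega> and the contraction rule\<close>

lemma form_eqI: "(\<And>z. \<omega> x z = \<omega> y z) \<Longrightarrow> x = y"
  using form_nondeg[of "x - y"] by (simp add: form_simps)

text \<open>The dual basis is encoded through coordinates: \<open>dual_basis e\<close> represents
  the \<open>e\<close>-coordinate functional under \<omega>, and \<open>dual_represented\<close>
  guarantees that such a vector exists.\<close>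

definition dual_basis :: "'v \<Rightarrow> 'v" where
  "dual_basis e = (SOME x. \<forall>v. \<omega> x v = representation Basis v e)"

lemma form_dual_basis: "\<omega> (dual_basis e) v = representation Basis v e"
proof -
  have "(\<lambda>v. representation Basis v e) \<in> dual scale"
    by (simp add: dual_def linear_representation independent_Basis span_Basis)
  then have "\<exists>x. \<forall>v. \<omega> x v = representation Basis v e"
    using dual_represented by metis
  then have "\<forall>v. \<omega> (dual_basis e) v = representation Basis v e"
    unfolding dual_basis_def by (rule someI_ex)
  then show ?thesis ..
qed

lemma dual_basis_expansion: "(\<Sum>e\<in>Basis. scale (\<omega> (dual_basis e) x) e) = x"
  unfolding form_dual_basis
  by (rule sum_representation_eq) (auto simp: independent_Basis span_Basis finite_Basis)

lemma form_expansion: "(\<Sum>e\<in>Basis. \<omega> (dual_basis e) x * \<omega> e y) = \<omega> x y"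
  \<comment> \<open>Going through \<open>arg_cong\<close> confines the expansion of \<open>x\<close>
    to the term \<open>\<omega> x y\<close>.\<close>
  by (subst dual_basis_expansion[of x, symmetric, THEN arg_cong[where f = "\<lambda>t. \<omega> t y"]])
    (simp add: form_simps)

lemma R_form_eq: "\<omega> (R x) y = - \<omega> x (R y) - \<omega> x y"
  using R_adjoint[of x y] by (simp add: algebra_simps eq_neg_iff_add_eq_0)

text \<open>Moving \<open>R\<close> off the dual basis by adjointness leaves two plain dual-basis
  expansions. This is the contraction rule for \<open>r\<close>: pairing its two legs with
  \<open>x\<close> and \<open>y\<close> gives \<open>\<omega> (R x) y\<close>. All later identities
  for \<open>r\<close> are computed with it.\<close>

lemma R_form_expansion: "(\<Sum>e\<in>Basis. \<omega> e x * \<omega> (R (dual_basis e)) y) = \<omega> (R x) y"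
proof -
  have "(\<Sum>e\<in>Basis. \<omega> e x * \<omega> (R (dual_basis e)) y)
      = (\<Sum>e\<in>Basis. - (\<omega> (dual_basis e) (R y) * \<omega> e x) - \<omega> (dual_basis e) y * \<omega> e x)"
    by (intro sum.cong refl) (simp add: R_form_eq algebra_simps)
  also have "\<dots> = - \<omega> (R y) x - \<omega> y x"
    by (simp add: sum_subtractf sum_negf form_expansion)
  also have "\<dots> = \<omega> (R x) y"
    unfolding R_form_eq[of x y] by (metis form_sym)
  finally show ?thesis .
qed

text \<open>By nondegeneracy the contraction rule becomes the formula for \<open>R\<close> that the
  theorem asserts.\<close>

lemma R_expansion: "(\<Sum>e\<in>Basis. scale (\<omega> e x) (R (dual_basis e))) = R x"
  by (rule form_eqI) (simp add: form_simps R_form_expansion)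

text \<open>A linear functional on bilinear (trilinear) forms is determined by the products of
  functionals \<open>\<omega> x\<close>, so tensor identities only need to be tested against those.\<close>

lemma bilinear_eq_0I:
  fixes T :: "('v \<Rightarrow> 'v \<Rightarrow> 'f) \<Rightarrow> 'f"
  assumes add: "\<And>\<beta> \<gamma>. T (\<lambda>x y. \<beta> x y + \<gamma> x y) = T \<beta> + T \<gamma>"
    and mult: "\<And>c \<beta>. T (\<lambda>x y. c * \<beta> x y) = c * T \<beta>"
    and prods: "\<And>p q. T (\<lambda>x y. \<omega> p x * \<omega> q y) = 0"
    and \<beta>: "bilinear_map scale (*) \<beta>"
  shows "T \<beta> = 0"
proof -
  have T0: "T (\<lambda>_ _. 0) = 0" using mult[of 0] by simp
  have sum: "T (\<lambda>x y. \<Sum>k\<in>K. \<gamma> k x y) = (\<Sum>k\<in>K. T (\<gamma> k))" for K :: "'v set" and \<gamma>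
    by (induction K rule: infinite_finite_induct) (auto simp: add T0)
  \<comment> \<open>Coordinates are themselves functionals \<open>\<omega> (dual_basis d)\<close>,
    so expanding both arguments in the basis writes \<beta> as a linear combination of the products
    covered by \<open>prods\<close>.\<close>
  have "\<beta> x y = (\<Sum>d\<in>Basis. \<Sum>e\<in>Basis. \<beta> d e * (\<omega> (dual_basis d) x * \<omega> (dual_basis e) y))" for x y
  proof -
    have x: "\<beta> x y = (\<Sum>d\<in>Basis. \<omega> (dual_basis d) x * \<beta> d y)"
      using arg_cong[OF dual_basis_expansion[of x], of "\<lambda>x. \<beta> x y"] by (simp add: bilinear_mapD[OF \<beta>])
    have y: "\<beta> d y = (\<Sum>e\<in>Basis. \<omega> (dual_basis e) y * \<beta> d e)" for d
      using arg_cong[OF dual_basis_expansion[of y], of "\<beta> d"] by (simp add: bilinear_mapD[OF \<beta>])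
    have "\<beta> x y = (\<Sum>d\<in>Basis. \<omega> (dual_basis d) x * (\<Sum>e\<in>Basis. \<omega> (dual_basis e) y * \<beta> d e))"
      by (subst x) (simp only: y)
    then show ?thesis by (simp add: sum_distrib_left mult_ac)
  qed
  then have "\<beta> = (\<lambda>x y. \<Sum>d\<in>Basis. \<Sum>e\<in>Basis.
      \<beta> d e * (\<omega> (dual_basis d) x * \<omega> (dual_basis e) y))"
    by (intro ext)
  from arg_cong[OF this, of T] show ?thesis by (simp add: sum mult prods)
qed

lemma trilinear_eq_0I:
  fixes T :: "('v \<Rightarrow> 'v \<Rightarrow> 'v \<Rightarrow> 'f) \<Rightarrow> 'f"
  assumes add: "\<And>\<beta> \<gamma>. T (\<lambda>x y z. \<beta> x y z + \<gamma> x y z) = T \<beta> + T \<gamma>"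
    and mult: "\<And>c \<beta>. T (\<lambda>x y z. c * \<beta> x y z) = c * T \<beta>"
    and prods: "\<And>p q r. T (\<lambda>x y z. \<omega> p x * \<omega> q y * \<omega> r z) = 0"
    and \<beta>: "trilinear_form scale \<beta>"
  shows "T \<beta> = 0"
proof -
  have T0: "T (\<lambda>_ _ _. 0) = 0" using mult[of 0] by simp
  have sum: "T (\<lambda>x y z. \<Sum>k\<in>K. \<gamma> k x y z) = (\<Sum>k\<in>K. T (\<gamma> k))" for K :: "'v set" and \<gamma>
    by (induction K rule: infinite_finite_induct) (auto simp: add T0)
  have "\<beta> x y z = (\<Sum>c\<in>Basis. \<Sum>d\<in>Basis. \<Sum>e\<in>Basis.
      \<beta> c d e * (\<omega> (dual_basis c) x * \<omega> (dual_basis d) y * \<omega> (dual_basis e) z))" for x y z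
  proof -
    have x: "\<beta> x y z = (\<Sum>c\<in>Basis. \<omega> (dual_basis c) x * \<beta> c y z)"
      using arg_cong[OF dual_basis_expansion[of x], of "\<lambda>x. \<beta> x y z"] by (simp add: trilinear_formD[OF \<beta>])
    have y: "\<beta> c y z = (\<Sum>d\<in>Basis. \<omega> (dual_basis d) y * \<beta> c d z)" for c
      using arg_cong[OF dual_basis_expansion[of y], of "\<lambda>y. \<beta> c y z"] by (simp add: trilinear_formD[OF \<beta>])
    have z: "\<beta> c d z = (\<Sum>e\<in>Basis. \<omega> (dual_basis e) z * \<beta> c d e)" for c d
      using arg_cong[OF dual_basis_expansion[of z], of "\<beta> c d"] by (simp add: trilinear_formD[OF \<beta>])
    have "\<beta> x y z = (\<Sum>c\<in>Basis. \<omega> (dual_basis c) x * (\<Sum>d\<in>Basis. \<omega> (dual_basis d) y * \<beta> c d z))"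
      by (subst x) (simp only: y)
    also have "\<dots> = (\<Sum>c\<in>Basis. \<omega> (dual_basis c) x * (\<Sum>d\<in>Basis. \<omega> (dual_basis d) y *
        (\<Sum>e\<in>Basis. \<omega> (dual_basis e) z * \<beta> c d e)))"
      by (subst z) (rule refl)
    finally show ?thesis by (simp add: sum_distrib_left mult_ac)
  qed
  then have "\<beta> = (\<lambda>x y z. \<Sum>c\<in>Basis. \<Sum>d\<in>Basis. \<Sum>e\<in>Basis.
      \<beta> c d e * (\<omega> (dual_basis c) x * \<omega> (dual_basis d) y * \<omega> (dual_basis e) z))"
    by (intro ext)
  from arg_cong[OF this, of T] show ?thesis by (simp add: sum mult prods)
qed

text \<open>The tensor \<open>r\<close> is the sum of \<open>e \<otimes> R (dual_basis e)\<close>.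
  It is kept as a list because \<open>tensor_sum\<close> takes lists; the choice operator only fixes
  some enumeration of the basis.\<close>

definition r_pairs :: "('v \<times> 'v) list" where
  "r_pairs = map (\<lambda>e. (e, R (dual_basis e))) (SOME es. distinct es \<and> set es = Basis)"

lemma sum_list_r_pairs: "(\<Sum>(x, y)\<leftarrow>r_pairs. F x y) = (\<Sum>e\<in>Basis. F e (R (dual_basis e)))"
proof -
  define es where "es = (SOME es. distinct es \<and> set es = Basis)"
  have "\<exists>es. distinct es \<and> set es = Basis"
    using finite_distinct_list[OF finite_Basis] by blast
  then have es: "distinct es \<and> set es = Basis"
    unfolding es_def by (rule someI_ex)
  show ?thesis
    unfolding r_pairs_def es_def[symmetric] using es
    by (simp add: o_def sum_list_distinct_conv_sum_set)
qed

section \<open>Evaluation of \<open>r\<close>; non-skewness, invariance and the Yang-Baxter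
  equation\<close>

lemma tensor_lift_r:
  assumes "bilinear_map scale s' \<beta>"
  shows "tensor_lift scale \<beta> (tensor_sum scale r_pairs) = (\<Sum>e\<in>Basis. \<beta> e (R (dual_basis e)))"
  by (simp add: tensor_lift_tensor_sum[OF assms] sum_list_r_pairs)

lemma R_eq_r: "R a = (\<Sum>(x, y)\<leftarrow>r_pairs. scale (\<omega> x a) y)"
  by (simp add: sum_list_r_pairs R_expansion)

lemma tensor_switch_r:
  assumes "bilinear_map scale (*) \<beta>"
  shows "tensor_switch scale (tensor_sum scale r_pairs) \<beta> = (\<Sum>e\<in>Basis. \<beta> (R (dual_basis e)) e)"
  unfolding tensor_switch_def tensor_lift_r[OF bilinear_pure_tensor_swap]
  using assms by (simp add: sum_fun_apply pure_tensor_def)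

lemma tensor_sum_r:
  assumes "bilinear_map scale (*) \<beta>"
  shows "tensor_sum scale r_pairs \<beta> = (\<Sum>e\<in>Basis. \<beta> e (R (dual_basis e)))"
  by (simp add: tensor_sum_apply[OF assms] sum_list_r_pairs)

text \<open>Paired with \<open>p\<close> and \<open>q\<close>, the tensor
  \<open>r + \<tau>(r)\<close> gives \<open>\<omega> (R p) q + \<omega> (R q) p\<close>, which is
  \<open>- \<omega> p q\<close> by adjointness. Skewness would therefore make \<omega>
  vanish.\<close>

lemma r_not_skew:
  assumes "(x::'v) \<noteq> 0"
  shows "tensor_switch scale (tensor_sum scale r_pairs) \<noteq> - tensor_sum scale r_pairs"
proof
  assume skew: "tensor_switch scale (tensor_sum scale r_pairs) = - tensor_sum scale r_pairs"
  have "\<omega> p q = 0" for p q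
  proof -
    have b: "bilinear_map scale (*) (\<lambda>x y. \<omega> x p * \<omega> y q)"
      by (rule bilinear_mapI) (auto simp: vector_space_axioms vector_space_field form_simps algebra_simps)
    have "(\<Sum>e\<in>Basis. \<omega> (R (dual_basis e)) p * \<omega> e q) = - (\<Sum>e\<in>Basis. \<omega> e p * \<omega> (R (dual_basis e)) q)"
      using fun_cong[OF skew, of "\<lambda>x y. \<omega> x p * \<omega> y q"]
      by (simp add: tensor_sum_r[OF b] tensor_switch_r[OF b])
    then have "\<omega> (R q) p = - \<omega> (R p) q"
      using R_form_expansion[of q p] R_form_expansion[of p q] by (simp add: mult.commute)
    then show ?thesis using R_adjoint[of p q] by (simp add: form_sym)
  qed
  then show False using form_nondeg assms by blast
qed

text \<open>Associativity and symmetry together make the trilinear form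
  \<open>\<omega> x (br y z)\<close> cyclic, which lets any chosen argument be freed from a
  bracket.\<close>

lemma form_cycle: "\<omega> x (br y z) = \<omega> y (br z x)"
  by (metis form_assoc form_sym)

lemma r_invariant:
  "tensor_invariant scale br (tensor_sum scale r_pairs + tensor_switch scale (tensor_sum scale r_pairs))"
  unfolding tensor_invariant_def
proof (intro allI ext)
  fix a and \<beta> :: "'v \<Rightarrow> 'v \<Rightarrow> 'f"
  let ?r = "tensor_sum scale r_pairs"
  let ?\<gamma> = "\<lambda>u v. pure_tensor scale (br u a) v + pure_tensor scale u (br v a)"
  have bil: "bilinear_map scale fun_scale ?\<gamma>"
    by (rule bilinear_mapI) (auto simp: vector_space_axioms vector_space_fun_scale br_simps
        bilinear_mapD[OF bilinear_pure_tensor] vector_space.vector_space_assms[OF vector_space_fun_scale])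
  \<comment> \<open>The value on \<beta> of the invariance expression; the four sums come from
    \<open>a\<close> acting on the first and second legs of \<open>r\<close>, then on the first and
    second legs of its switch.\<close>
  define T where "T \<beta> = (\<Sum>e\<in>Basis. \<beta> (br e a) (R (dual_basis e))) + (\<Sum>e\<in>Basis. \<beta> e (br (R (dual_basis e)) a))
     + (\<Sum>e\<in>Basis. \<beta> (br (R (dual_basis e)) a) e) + (\<Sum>e\<in>Basis. \<beta> (R (dual_basis e)) (br e a))"
    for \<beta> :: "'v \<Rightarrow> 'v \<Rightarrow> 'f"
  \<comment> \<open>The switch of a list tensor is the tensor of the swapped list, so the whole
    argument is a single \<open>tensor_sum\<close> over a concatenation and the lift can be
    evaluated.\<close>
  have "tensor_lift scale ?\<gamma> (?r + tensor_switch scale ?r)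
      = (\<Sum>e\<in>Basis. ?\<gamma> e (R (dual_basis e))) + (\<Sum>e\<in>Basis. ?\<gamma> (R (dual_basis e)) e)"
  proof -
    have "(\<Sum>(x, y)\<leftarrow>map (\<lambda>(x, y). (y, x)) ab. f x y) = (\<Sum>(x, y)\<leftarrow>ab. f y x)"
      for ab :: "('v \<times> 'v) list" and f :: "'v \<Rightarrow> 'v \<Rightarrow> ('f, 'v) tensor"
      by (induction ab) auto
    then show ?thesis
      unfolding tensor_switch_tensor_sum tensor_sum_append[symmetric] tensor_lift_tensor_sum[OF bil]
        map_append sum_list_append by (simp only: sum_list_r_pairs)
  qed
  \<comment> \<open>Pure tensors are set to 0 off the bilinear forms, hence the case
    distinction.\<close>
  then have "tensor_lift scale ?\<gamma> (?r + tensor_switch scale ?r) \<beta>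
      = (if bilinear_map scale (*) \<beta> then T \<beta> else 0)"
    by (simp add: sum_fun_apply pure_tensor_def T_def sum.distrib)
  moreover have "T \<beta> = 0" if \<beta>: "bilinear_map scale (*) \<beta>"
  proof -
    have add: "T (\<lambda>x y. \<beta> x y + \<gamma> x y) = T \<beta> + T \<gamma>" for \<beta> \<gamma>
      by (simp add: T_def sum.distrib)
    have mult: "T (\<lambda>x y. c * \<beta> x y) = c * T \<beta>" for c \<beta>
      by (simp add: T_def sum_distrib_left distrib_left)
    have "T (\<lambda>x y. \<omega> p x * \<omega> q y) = 0" for p q
    proof -
      have 1: "(\<Sum>e\<in>Basis. \<omega> p (br e a) * \<omega> q (R (dual_basis e))) = \<omega> (R (br a p)) q"
        by (subst R_form_expansion[symmetric], intro sum.cong refl) (metis form_sym form_cycle)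
      have 2: "(\<Sum>e\<in>Basis. \<omega> p e * \<omega> q (br (R (dual_basis e)) a)) = \<omega> (R p) (br a q)"
        by (subst R_form_expansion[symmetric], intro sum.cong refl) (metis form_sym form_cycle)
      have 3: "(\<Sum>e\<in>Basis. \<omega> p (br (R (dual_basis e)) a) * \<omega> q e) = \<omega> (R q) (br a p)"
        by (subst R_form_expansion[symmetric], intro sum.cong refl) (metis form_sym form_cycle mult.commute)
      have 4: "(\<Sum>e\<in>Basis. \<omega> p (R (dual_basis e)) * \<omega> q (br e a)) = \<omega> (R (br a q)) p"
        by (subst R_form_expansion[symmetric], intro sum.cong refl) (metis form_sym form_cycle mult.commute)
      \<comment> \<open>The sums are grouped by the leg on which \<open>a\<close> acts. Adjointness
        removes \<open>R\<close> from each group, and the two remainders cancel by cyclicity and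
        anti-commutativity.\<close>
      have 5: "\<omega> (R (br a p)) q + \<omega> (R q) (br a p) = - \<omega> q (br a p)"
        unfolding R_form_eq[of "br a p"] by (simp add: form_sym[of q] form_sym[of "R q"])
      have 6: "\<omega> (R p) (br a q) + \<omega> (R (br a q)) p = - \<omega> p (br a q)"
        unfolding R_form_eq[of p] by (simp add: form_sym[of p])
      have 7: "\<omega> p (br a q) = - \<omega> q (br a p)"
        by (metis form_cycle br_anticommute form_simps(8))
      have "T (\<lambda>x y. \<omega> p x * \<omega> q y)
          = (\<omega> (R (br a p)) q + \<omega> (R q) (br a p)) + (\<omega> (R p) (br a q) + \<omega> (R (br a q)) p)"
        unfolding T_def 1 2 3 4 by (simp only: ac_simps)
      also have "\<dots> = 0" unfolding 5 6 7 by simp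
      finally show ?thesis .
    qed
    then show ?thesis by (rule bilinear_eq_0I[where T = T, OF add mult _ \<beta>])
  qed
  ultimately show "tensor_lift scale ?\<gamma> (?r + tensor_switch scale ?r) \<beta> = 0 \<beta>" by simp
qed

text \<open>Contracting the three legs with \<open>p\<close>, \<open>q\<close>, \<open>r\<close>
  turns the Yang-Baxter expression into a combination of terms \<open>\<omega> q (...)\<close>,
  which vanishes by the Rota-Baxter identity for the pair \<open>r\<close>,
  \<open>p\<close>.\<close>

lemma r_cybe: "cybe_solution scale br (tensor_sum scale r_pairs)"
  unfolding cybe_solution_def
proof (intro ext)
  fix \<beta> :: "'v \<Rightarrow> 'v \<Rightarrow> 'v \<Rightarrow> 'f"
  interpret F: vector_space "fun_scale :: 'f \<Rightarrow> (('v \<Rightarrow> 'v \<Rightarrow> 'v \<Rightarrow> 'f) \<Rightarrow> 'f) \<Rightarrow> _"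
    by (rule vector_space_fun_scale)
  let ?r = "tensor_sum scale r_pairs"
  let ?t = "pure_tensor3 scale"
  let ?g = "\<lambda>a b a' b'. ?t (br a a') b b' - ?t a (br a' b) b' + ?t a a' (br b b')"
  note simps = br_simps pure_tensor3_linear
    F.scale_right_distrib F.scale_right_diff_distrib F.scale_sum_right
  \<comment> \<open>The Yang-Baxter expression nests two lifts. The inner one is evaluated first,
    and its value must again be bilinear in the outer pair before the second can be
    evaluated.\<close>
  have inner: "bilinear_map scale fun_scale (?g a b)" for a b
    by (rule bilinear_mapI)
      (simp_all add: vector_space_axioms F.vector_space_axioms simps algebra_simps)
  have outer: "bilinear_map scale fun_scale (\<lambda>a b. \<Sum>e\<in>Basis. ?g a b e (R (dual_basis e)))"
    by (rule bilinear_mapI)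
      (simp_all add: vector_space_axioms F.vector_space_axioms simps sum.distrib sum_subtractf algebra_simps)
  define R' where "R' e = R (dual_basis e)" for e
  define T where "T \<beta> = (\<Sum>d\<in>Basis. \<Sum>e\<in>Basis. \<beta> (br d e) (R' d) (R' e))
     - (\<Sum>d\<in>Basis. \<Sum>e\<in>Basis. \<beta> d (br e (R' d)) (R' e))
     + (\<Sum>d\<in>Basis. \<Sum>e\<in>Basis. \<beta> d e (br (R' d) (R' e)))"
    for \<beta> :: "'v \<Rightarrow> 'v \<Rightarrow> 'v \<Rightarrow> 'f"
  have exp: "(\<Sum>e\<in>Basis. \<omega> e x * \<omega> (R' e) y) = \<omega> (R x) y" for x y
    unfolding R'_def by (rule R_form_expansion)
  have "tensor_lift scale (\<lambda>a b. tensor_lift scale (?g a b) ?r) ?r \<beta>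
      = (if trilinear_form scale \<beta> then T \<beta> else 0)"
    unfolding tensor_lift_r[OF inner] tensor_lift_r[OF outer]
    by (simp add: sum_fun_apply pure_tensor3_def T_def R'_def sum.distrib sum_subtractf)
  moreover have "T \<beta> = 0" if \<beta>: "trilinear_form scale \<beta>"
  proof -
    have add: "T (\<lambda>x y z. \<beta> x y z + \<gamma> x y z) = T \<beta> + T \<gamma>" for \<beta> \<gamma>
      by (simp add: T_def sum.distrib)
    have mult: "T (\<lambda>x y z. c * \<beta> x y z) = c * T \<beta>" for c \<beta>
      by (simp add: T_def sum_distrib_left distrib_left right_diff_distrib)
    have "T (\<lambda>x y z. \<omega> p x * \<omega> q y * \<omega> r z) = 0" for p q r
    proof -
      \<comment> \<open>In each of the three double sums \<open>d\<close> is held fixed and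
        \<open>e\<close> is freed from its bracket, so that \<open>exp\<close> contracts it; after
        rearrangement \<open>exp\<close> contracts \<open>d\<close> as well. In the first two sums
        adjointness moves \<open>R\<close> onto \<open>r\<close> in between.\<close>
      have 1: "(\<Sum>d\<in>Basis. \<Sum>e\<in>Basis. \<omega> p (br d e) * \<omega> q (R' d) * \<omega> r (R' e))
          = - \<omega> (R (br (R r) p + br r p)) q"
      proof -
        have "(\<Sum>e\<in>Basis. \<omega> p (br d e) * \<omega> q (R' d) * \<omega> r (R' e))
            = - (\<omega> d (br (R r) p + br r p) * \<omega> (R' d) q)" for d
        proof -
          have "(\<Sum>e\<in>Basis. \<omega> p (br d e) * \<omega> q (R' d) * \<omega> r (R' e))
              = (\<Sum>e\<in>Basis. \<omega> e (br p d) * \<omega> (R' e) r) * \<omega> (R' d) q"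
            unfolding sum_distrib_right
            by (intro sum.cong refl) (metis form_sym form_assoc mult.commute mult.assoc)
          moreover have "\<omega> (br p d) z = \<omega> d (br z p)" for z
            by (metis form_sym form_cycle)
          then have "\<omega> (R (br p d)) r = - \<omega> d (br (R r) p + br r p)"
            unfolding R_form_eq[of "br p d"] by (simp add: form_simps)
          ultimately show ?thesis
            unfolding exp by simp
        qed
        then show ?thesis by (simp add: sum_negf exp)
      qed
      have 2: "(\<Sum>d\<in>Basis. \<Sum>e\<in>Basis. \<omega> p d * \<omega> q (br e (R' d)) * \<omega> r (R' e))
          = - \<omega> (R p) (br q (R r) + br q r)"
      proof -
        have "(\<Sum>e\<in>Basis. \<omega> p d * \<omega> q (br e (R' d)) * \<omega> r (R' e))
            = - (\<omega> d p * \<omega> (R' d) (br q (R r) + br q r))" for d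
        proof -
          have "(\<Sum>e\<in>Basis. \<omega> p d * \<omega> q (br e (R' d)) * \<omega> r (R' e))
              = (\<Sum>e\<in>Basis. \<omega> e (br (R' d) q) * \<omega> (R' e) r) * \<omega> d p"
            unfolding sum_distrib_right
            by (intro sum.cong refl) (metis form_sym form_cycle mult.commute mult.assoc)
          also have "\<dots> = - (\<omega> d p * \<omega> (R' d) (br q (R r) + br q r))"
            unfolding exp R_form_eq[of "br (R' d) q"] by (simp add: form_simps form_assoc algebra_simps)
          finally show ?thesis .
        qed
        then show ?thesis by (simp add: sum_negf exp)
      qed
      have 3: "(\<Sum>d\<in>Basis. \<Sum>e\<in>Basis. \<omega> p d * \<omega> q e * \<omega> r (br (R' d) (R' e))) = \<omega> (R p) (br (R q) r)"
      proof -
        have "(\<Sum>e\<in>Basis. \<omega> p d * \<omega> q e * \<omega> r (br (R' d) (R' e))) = \<omega> d p * \<omega> (R' d) (br (R q) r)" for d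
        proof -
          have "(\<Sum>e\<in>Basis. \<omega> p d * \<omega> q e * \<omega> r (br (R' d) (R' e)))
              = (\<Sum>e\<in>Basis. \<omega> e q * \<omega> (R' e) (br r (R' d))) * \<omega> d p"
            unfolding sum_distrib_right
            by (intro sum.cong refl) (metis form_sym form_cycle mult.commute mult.assoc)
          then show ?thesis unfolding exp by (metis form_cycle mult.commute)
        qed
        then show ?thesis by (simp add: exp)
      qed
      \<comment> \<open>All three values are now rewritten as pairings with \<open>q\<close>. The
        Rota-Baxter identity enters in the third equation, and then everything cancels.\<close>
      have "\<omega> (R p) (br (R q) r) = - \<omega> q (R (br r (R p))) - \<omega> q (br r (R p))"
        by (metis form_cycle R_form_eq)
      moreover have "\<omega> (R p) (br q (R r) + br q r) = \<omega> q (br (R r) (R p)) + \<omega> q (br r (R p))"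
        by (metis form_cycle form_simps(2))
      moreover have "\<omega> (R (br (R r) p + br r p)) q = \<omega> q (br (R r) (R p)) - \<omega> q (R (br r (R p)))"
        unfolding rota_baxter[of r p] by (simp add: R.add form_simps form_sym[of _ q])
      ultimately show ?thesis
        unfolding T_def 1 2 3 by simp
    qed
    then show ?thesis by (rule trilinear_eq_0I[where T = T, OF add mult _ \<beta>])
  qed
  ultimately show "tensor_lift scale (\<lambda>a b. tensor_lift scale (?g a b) ?r) ?r \<beta> = 0 \<beta>" by simp
qed

end

section \<open>The Drinfeld double\<close>

lemma dualD:
  assumes "f \<in> dual s"
  shows "f (x + y) = f x + f y" "f (s c x) = c * f x" "f 0 = 0" "f (- x) = - f x" "f (x - y) = f x - f y"
proof -
  interpret Vector_Spaces.linear s "(*)" f using assms by (simp add: dual_def)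
  show "f (x + y) = f x + f y" "f (s c x) = c * f x" "f 0 = 0" "f (- x) = - f x" "f (x - y) = f x - f y"
    by (fact add scale zero neg diff)+
qed

lemma (in vector_space) dualI:
  "(\<And>x y. f (x + y) = f x + f y) \<Longrightarrow> (\<And>c x. f (scale c x) = c * f x) \<Longrightarrow> f \<in> dual scale"
  by (simp add: dual_def Vector_Spaces.linear_iff vector_space_axioms vector_space_field)

locale double_algebra = finite_dimensional_vector_space scale Basis
  for scale :: "'f::field \<Rightarrow> 'v::ab_group_add \<Rightarrow> 'v" and Basis +
  fixes br :: "'v \<Rightarrow> 'v \<Rightarrow> 'v" and \<Delta> :: "'v \<Rightarrow> ('f, 'v) tensor"
  assumes br_bilinear: "bilinear_map scale scale br"
    and simple_br: "simple_algebra scale UNIV br"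
    and comultiplication: "comultiplication scale \<Delta>"
begin

abbreviation dcarrier where "dcarrier \<equiv> double_carrier scale"
abbreviation dmult where "dmult \<equiv> double_mult scale br \<Delta>"
abbreviation dscale where "dscale \<equiv> double_scale scale"

text \<open>The vector space is the whole type of pairs with arbitrary functions; the double itself
  is the subset \<open>dcarrier\<close>, where the second component is linear.\<close>

sublocale double: vector_space dscale
  by unfold_locales
    (auto simp: double_scale_def fun_scale_def fun_eq_iff scale_right_distrib scale_left_distrib algebra_simps)

lemmas br_simps = bilinear_mapD[OF br_bilinear]

section \<open>Harpoons and products in the double\<close>

lemma zero_dual: "0 \<in> dual scale"
  by (rule dualI) simp_all

lemma in_dcarrier: "p \<in> dcarrier \<longleftrightarrow> snd p \<in> dual scale"
  by (cases p) (simp add: double_carrier_def)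

text \<open>This replaces Sweedler notation: the list supplies the pairs a(1), a(2). The evaluations
  below need linear functionals, since only then is the lifted map bilinear.\<close>

lemma comultiplication_sum: obtains ab where "\<Delta> a = tensor_sum scale ab"
  using comultiplication unfolding comultiplication_def tensor_square_eq by blast

lemma left_harpoon_sum:
  assumes "\<Delta> a = tensor_sum scale ab" "f \<in> dual scale"
  shows "left_harpoon scale \<Delta> f a = (\<Sum>(x, y)\<leftarrow>ab. scale (f y) x)"
  unfolding left_harpoon_def assms(1)
  by (rule tensor_lift_tensor_sum, rule bilinear_mapI[where s' = scale])
    (auto simp: vector_space_axioms dualD[OF assms(2)] scale_left_distrib scale_right_distrib mult.commute)

lemma right_harpoon_sum:
  assumes "\<Delta> a = tensor_sum scale ab" "f \<in> dual scale"
  shows "right_harpoon scale \<Delta> a f = (\<Sum>(x, y)\<leftarrow>ab. scale (f x) y)"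
  unfolding right_harpoon_def assms(1)
  by (rule tensor_lift_tensor_sum, rule bilinear_mapI[where s' = scale])
    (auto simp: vector_space_axioms dualD[OF assms(2)] scale_left_distrib scale_right_distrib mult.commute)

lemma dual_mult_sum:
  assumes "\<Delta> a = tensor_sum scale ab" "f \<in> dual scale" "g \<in> dual scale"
  shows "dual_mult scale \<Delta> f g a = (\<Sum>(x, y)\<leftarrow>ab. f x * g y)"
  unfolding dual_mult_def assms(1)
  by (rule tensor_lift_tensor_sum, rule bilinear_mapI[where s' = "(*)"])
    (auto simp: vector_space_axioms vector_space_field dualD[OF assms(2)] dualD[OF assms(3)] algebra_simps)

text \<open>Both sides are the sum of g(a(1)) f(a(2)). Thus the harpoon is the transpose of right
  multiplication by \<open>f\<close> in the dual algebra, which is what makes the canonical form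
  associative.\<close>

lemma dual_left_harpoon:
  assumes "f \<in> dual scale" "g \<in> dual scale"
  shows "g (left_harpoon scale \<Delta> f a) = dual_mult scale \<Delta> g f a"
proof -
  obtain ab where ab: "\<Delta> a = tensor_sum scale ab" by (rule comultiplication_sum)
  have "g (\<Sum>(x, y)\<leftarrow>ab. scale (f y) x) = (\<Sum>(x, y)\<leftarrow>ab. g x * f y)"
    by (induction ab) (auto simp: dualD[OF assms(2)] mult.commute)
  then show ?thesis by (simp add: left_harpoon_sum[OF ab] dual_mult_sum[OF ab] assms)
qed

lemma dual_right_harpoon:
  assumes "f \<in> dual scale" "g \<in> dual scale"
  shows "g (right_harpoon scale \<Delta> a f) = dual_mult scale \<Delta> f g a"
proof -
  obtain ab where ab: "\<Delta> a = tensor_sum scale ab" by (rule comultiplication_sum)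
  have "g (\<Sum>(x, y)\<leftarrow>ab. scale (f x) y) = (\<Sum>(x, y)\<leftarrow>ab. f x * g y)"
    by (induction ab) (auto simp: dualD[OF assms(2)])
  then show ?thesis by (simp add: right_harpoon_sum[OF ab] dual_mult_sum[OF ab] assms)
qed

lemma diff_dual: "f \<in> dual scale \<Longrightarrow> g \<in> dual scale \<Longrightarrow> f - g \<in> dual scale"
  by (rule dualI) (auto simp: dualD[where s = scale] algebra_simps)

lemma left_harpoon_diff:
  assumes "f \<in> dual scale" "g \<in> dual scale"
  shows "left_harpoon scale \<Delta> (f - g) a = left_harpoon scale \<Delta> f a - left_harpoon scale \<Delta> g a"
proof -
  obtain ab where ab: "\<Delta> a = tensor_sum scale ab" by (rule comultiplication_sum)
  have "(\<Sum>(x, y)\<leftarrow>ab. scale ((f - g) y) x) = (\<Sum>(x, y)\<leftarrow>ab. scale (f y) x) - (\<Sum>(x, y)\<leftarrow>ab. scale (g y) x)"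
    by (induction ab) (auto simp: scale_left_diff_distrib)
  then show ?thesis by (simp add: left_harpoon_sum[OF ab] assms diff_dual)
qed

lemma right_harpoon_diff:
  assumes "f \<in> dual scale" "g \<in> dual scale"
  shows "right_harpoon scale \<Delta> a (f - g) = right_harpoon scale \<Delta> a f - right_harpoon scale \<Delta> a g"
proof -
  obtain ab where ab: "\<Delta> a = tensor_sum scale ab" by (rule comultiplication_sum)
  have "(\<Sum>(x, y)\<leftarrow>ab. scale ((f - g) x) y) = (\<Sum>(x, y)\<leftarrow>ab. scale (f x) y) - (\<Sum>(x, y)\<leftarrow>ab. scale (g x) y)"
    by (induction ab) (auto simp: scale_left_diff_distrib)
  then show ?thesis by (simp add: right_harpoon_sum[OF ab] assms diff_dual)
qed

lemma harpoon_zero: "left_harpoon scale \<Delta> 0 a = 0" "right_harpoon scale \<Delta> a 0 = 0"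
  using left_harpoon_diff[OF zero_dual zero_dual, of a] right_harpoon_diff[OF zero_dual zero_dual, of a]
  by simp_all

lemma dual_mult_zero: "f \<in> dual scale \<Longrightarrow> dual_mult scale \<Delta> f 0 = 0" "f \<in> dual scale \<Longrightarrow> dual_mult scale \<Delta> 0 f = 0"
proof -
  assume f: "f \<in> dual scale"
  show "dual_mult scale \<Delta> f 0 = 0"
    using dual_left_harpoon[OF zero_dual f] by (simp add: fun_eq_iff harpoon_zero dualD[OF f])
  show "dual_mult scale \<Delta> 0 f = 0"
    using dual_right_harpoon[OF zero_dual f] by (simp add: fun_eq_iff harpoon_zero dualD[OF f])
qed

lemma dmult_right_base:
  "f \<in> dual scale \<Longrightarrow> dmult (a, f) (c, 0) = (br a c + left_harpoon scale \<Delta> f c, \<lambda>x. f (br c x))"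
  by (simp add: double_mult_def harpoon_zero dual_mult_zero fun_eq_iff)

lemma dmult_left_base:
  "f \<in> dual scale \<Longrightarrow> dmult (c, 0) (a, f) = (br c a + right_harpoon scale \<Delta> c f, \<lambda>x. f (br x c))"
  by (simp add: double_mult_def harpoon_zero dual_mult_zero fun_eq_iff)

lemma dmult_base: "dmult (a, 0) (c, 0) = (br a c, 0)"
  by (simp add: dmult_right_base zero_dual harpoon_zero fun_eq_iff)

section \<open>The canonical form and the ideals of the double\<close>

definition pairing :: "'v \<times> ('v \<Rightarrow> 'f) \<Rightarrow> 'v \<times> ('v \<Rightarrow> 'f) \<Rightarrow> 'f" where
  "pairing p q = snd p (fst q) + snd q (fst p)"

text \<open>For a + f, b + g, c + h both sides expand to f[b,c] + g[c,a] + h[a,b] + (fg)(c) +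
  (gh)(a) + (hf)(b).\<close>

lemma pairing_assoc:
  assumes "p \<in> dcarrier" "q \<in> dcarrier" "r \<in> dcarrier"
  shows "pairing (dmult p q) r = pairing p (dmult q r)"
proof -
  obtain a f b g c h where pqr: "p = (a, f)" "q = (b, g)" "r = (c, h)"
    by (metis prod.exhaust)
  have d: "f \<in> dual scale" "g \<in> dual scale" "h \<in> dual scale"
    using assms by (simp_all add: pqr in_dcarrier)
  show ?thesis
    by (simp add: pqr pairing_def double_mult_def dualD(1)[OF d(1)] dualD(1)[OF d(3)]
        dual_left_harpoon dual_right_harpoon d)
qed

text \<open>The span of the products of \<open>I\<close> is a nonzero ideal of \<open>I\<close>, so
  by simplicity it is \<open>I\<close>. For a product of \<open>x\<close> and \<open>y\<close> in
  \<open>I\<close>, associativity gives <xy, z> = <x, yz>, and yz lies in both ideals, hence is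
  0.\<close>

lemma ideals_orthogonal:
  assumes I: "simple_ideal dscale dcarrier dmult I" and J: "simple_ideal dscale dcarrier dmult J"
    and IJ: "I \<inter> J = {0}" and "x \<in> I" "z \<in> J"
  shows "pairing x z = 0"
proof -
  have Ic: "I \<subseteq> dcarrier" and Is: "double.subspace I"
    and Im: "\<And>x y. x \<in> dcarrier \<Longrightarrow> y \<in> I \<Longrightarrow> dmult x y \<in> I \<and> dmult y x \<in> I"
    using I by (auto simp: simple_ideal_def two_sided_ideal_def)
  have Jc: "J \<subseteq> dcarrier" and Jm: "\<And>x y. x \<in> dcarrier \<Longrightarrow> y \<in> J \<Longrightarrow> dmult x y \<in> J"
    using J by (auto simp: simple_ideal_def two_sided_ideal_def)
  define G where "G = {dmult x y | x y. x \<in> I \<and> y \<in> I}"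
  have "G \<subseteq> I" using Im Ic by (auto simp: G_def)
  then have GI: "double.span G \<subseteq> I" using Is by (rule double.span_minimal)
  have "two_sided_ideal dscale I dmult (double.span G)"
    unfolding two_sided_ideal_def
  proof (intro conjI ballI)
    fix x y assume "x \<in> I" "y \<in> double.span G"
    then have "dmult x y \<in> G" "dmult y x \<in> G" using GI unfolding G_def by blast+
    then show "dmult x y \<in> double.span G" "dmult y x \<in> double.span G" by (auto intro: double.span_base)
  qed (auto simp: GI)
  moreover have "simple_algebra dscale I dmult" using I by (simp add: simple_ideal_def)
  moreover from this obtain u v where "u \<in> I" "v \<in> I" "dmult u v \<noteq> 0"
    by (auto simp: simple_algebra_def)
  moreover from this have "dmult u v \<in> double.span G"
    unfolding G_def by (intro double.span_base) blast
  ultimately have "double.span G = I"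
    by (auto simp: simple_algebra_def)
  moreover have "double.span G \<subseteq> {w. pairing w z = 0}"
  proof (rule double.span_minimal)
    have z: "snd z \<in> dual scale" using \<open>z \<in> J\<close> Jc by (auto simp: in_dcarrier)
    show "double.subspace {w. pairing w z = 0}"
      by (rule double.subspaceI)
        (auto simp: pairing_def double_scale_def fun_scale_def case_prod_unfold dualD[OF z] algebra_simps
          simp flip: distrib_left)
    show "G \<subseteq> {w. pairing w z = 0}"
    proof
      fix w assume "w \<in> G"
      then obtain x y where w: "w = dmult x y" "x \<in> I" "y \<in> I" by (auto simp: G_def)
      then have "dmult y z \<in> I \<inter> J" using Im Jm Ic Jc \<open>z \<in> J\<close> by blast
      then have "dmult y z = 0" using IJ by blast
      \<comment> \<open>Pairing \<open>x\<close> with 0 evaluates the functional of \<open>x\<close>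
        at 0, so its linearity is used here.\<close>
      moreover have "snd x 0 = 0" using w Ic dualD(3)[of "snd x"] by (auto simp: in_dcarrier)
      ultimately show "w \<in> {w. pairing w z = 0}"
        using pairing_assoc[of x y z] w Ic Jc \<open>z \<in> J\<close> by (auto simp: pairing_def)
    qed
  qed
  ultimately show ?thesis using \<open>x \<in> I\<close> by blast
qed

text \<open>By \<open>dmult_base\<close> the copy of L is a subalgebra, so an ideal of the double
  cuts out an ideal of L.\<close>

lemma subalgebra_inter_ideal:
  assumes I: "two_sided_ideal dscale dcarrier dmult I"
  shows "{a. (a, 0) \<in> I} = {0} \<or> {a. (a, 0) \<in> I} = UNIV"
proof -
  have Is: "double.subspace I" and Im: "\<And>x y. x \<in> dcarrier \<Longrightarrow> y \<in> I \<Longrightarrow> dmult x y \<in> I \<and> dmult y x \<in> I"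
    using I by (auto simp: two_sided_ideal_def)
  have "two_sided_ideal scale UNIV br {a. (a, 0) \<in> I}"
    unfolding two_sided_ideal_def
  proof (intro conjI ballI)
    show "subspace {a. (a, 0) \<in> I}"
    proof (rule subspaceI)
      show "0 \<in> {a. (a, 0) \<in> I}" using double.subspace_0[OF Is] by (simp add: zero_prod_def)
      show "x + y \<in> {a. (a, 0) \<in> I}" if "x \<in> {a. (a, 0) \<in> I}" "y \<in> {a. (a, 0) \<in> I}" for x y
        using double.subspace_add[OF Is, of "(x, 0)" "(y, 0)"] that by simp
      show "scale c x \<in> {a. (a, 0) \<in> I}" if "x \<in> {a. (a, 0) \<in> I}" for c x
        using double.subspace_scale[OF Is, of "(x, 0)" c] that
        by (simp add: double_scale_def fun_scale_def zero_fun_def)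
    qed
    fix x y assume "y \<in> {a. (a, 0) \<in> I}"
    then show "br x y \<in> {a. (a, 0) \<in> I}" "br y x \<in> {a. (a, 0) \<in> I}"
      using Im[of "(x, 0)" "(y, 0)"] by (simp_all add: in_dcarrier zero_dual dmult_base)
  qed simp
  then show ?thesis using simple_br by (simp add: simple_algebra_def)
qed

text \<open>Otherwise \<open>I\<close> contains all of L. Orthogonality to L kills the functional
  parts of \<open>J\<close>, so \<open>J\<close> lies in L and hence in \<open>I\<close>; then
  \<open>J\<close> is 0, although a simple ideal has a nonzero product.\<close>

lemma ideal_meets_base_trivially:
  assumes I: "simple_ideal dscale dcarrier dmult I" and J: "simple_ideal dscale dcarrier dmult J"
    and IJ: "I \<inter> J = {0}" and a: "(a, 0) \<in> I"
  shows "a = 0"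
proof (rule ccontr)
  assume "a \<noteq> 0"
  then have all: "(b, 0) \<in> I" for b
    using subalgebra_inter_ideal[of I] I a by (auto simp: simple_ideal_def)
  have "z = 0" if z: "z \<in> J" for z
  proof -
    obtain c h where ch: "z = (c, h)" by force
    have "h = 0"
      using ideals_orthogonal[OF I J IJ all z] by (simp add: pairing_def ch fun_eq_iff)
    then have "z \<in> I" using all by (simp add: ch)
    then show ?thesis using z IJ by blast
  qed
  moreover obtain u v where "u \<in> J" "v \<in> J" "dmult u v \<noteq> 0"
    using J by (auto simp: simple_ideal_def simple_algebra_def)
  moreover have "dmult u v \<in> J"
    using J \<open>u \<in> J\<close> \<open>v \<in> J\<close> by (auto simp: simple_ideal_def two_sided_ideal_def)
  ultimately show False by blast
qed

end

section \<open>Doubles with two simple summands\<close>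

text \<open>The direct sum is recast as existence (\<open>decompose\<close>) and uniqueness
  (\<open>inter\<close>) of the splitting.\<close>

locale split_double = double_algebra scale Basis br \<Delta>
  for scale :: "'f::field \<Rightarrow> 'v::ab_group_add \<Rightarrow> 'v" and Basis br and \<Delta> +
  fixes L1 L2 :: "('v \<times> ('v \<Rightarrow> 'f)) set"
  assumes L1_simple: "simple_ideal dscale dcarrier dmult L1"
    and L2_simple: "simple_ideal dscale dcarrier dmult L2"
    and inter: "L1 \<inter> L2 = {0}"
    and decompose: "p \<in> dcarrier \<Longrightarrow> \<exists>x\<in>L1. p - x \<in> L2"
begin

lemma ideals_subspace: "double.subspace L1" "double.subspace L2"
  and ideals_carrier: "L1 \<subseteq> dcarrier" "L2 \<subseteq> dcarrier"
  using L1_simple L2_simple by (auto simp: simple_ideal_def two_sided_ideal_def)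

lemma ideals_mult:
  "x \<in> dcarrier \<Longrightarrow> y \<in> L1 \<Longrightarrow> dmult x y \<in> L1" "x \<in> dcarrier \<Longrightarrow> y \<in> L1 \<Longrightarrow> dmult y x \<in> L1"
  "x \<in> dcarrier \<Longrightarrow> y \<in> L2 \<Longrightarrow> dmult x y \<in> L2" "x \<in> dcarrier \<Longrightarrow> y \<in> L2 \<Longrightarrow> dmult y x \<in> L2"
  using L1_simple L2_simple by (auto simp: simple_ideal_def two_sided_ideal_def)

lemma base_trivial: "(a, 0) \<in> L1 \<Longrightarrow> a = 0" "(a, 0) \<in> L2 \<Longrightarrow> a = 0"
  using ideal_meets_base_trivially[OF L1_simple L2_simple inter]
    ideal_meets_base_trivially[OF L2_simple L1_simple] inter by (auto simp: Int_commute)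

text \<open>Writing the \<open>L1\<close>-component of \<open>a\<close> as \<open>S a - R a\<close>, the maps \<open>R\<close> and \<open>S\<close> are
  \<open>\<phi>\<^sub>1 \<circ> \<psi>\<close> and \<open>\<psi>\<close>.\<close>

definition component :: "'v \<Rightarrow> 'v \<times> ('v \<Rightarrow> 'f)" where
  "component a = (SOME x. x \<in> L1 \<and> (a, 0) - x \<in> L2)"

definition R :: "'v \<Rightarrow> 'v" where "R a = - fst (component a)"

definition S :: "'v \<Rightarrow> 'v \<Rightarrow> 'f" where "S a = snd (component a)"

lemma component_mem: "component a \<in> L1" "(a, 0) - component a \<in> L2"
proof -
  have "\<exists>x. x \<in> L1 \<and> (a, 0) - x \<in> L2"
    using decompose[of "(a, 0)"] unfolding in_dcarrier Bex_def by (simp add: zero_dual)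
  then have "component a \<in> L1 \<and> (a, 0) - component a \<in> L2"
    unfolding component_def by (rule someI_ex)
  then show "component a \<in> L1" "(a, 0) - component a \<in> L2" by auto
qed

lemma component_eq: "component a = (- R a, S a)"
  by (simp add: R_def S_def)

text \<open>Two candidates differ by an element of both ideals. Later identities for
  \<open>R\<close> and \<open>S\<close> are obtained by exhibiting the right candidate and comparing
  coordinates.\<close>

lemma component_unique:
  assumes "x \<in> L1" "(a, 0) - x \<in> L2"
  shows "component a = x"
proof -
  have "component a - x \<in> L1"
    by (rule double.subspace_diff[OF ideals_subspace(1) component_mem(1) assms(1)])
  moreover have "((a, 0) - x) - ((a, 0) - component a) \<in> L2"
    by (rule double.subspace_diff[OF ideals_subspace(2) assms(2) component_mem(2)])
  then have "component a - x \<in> L2" by (simp add: algebra_simps)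
  ultimately have "component a - x = 0" using inter by blast
  then show ?thesis by simp
qed

lemma S_dual: "S a \<in> dual scale"
  using component_mem(1)[of a] ideals_carrier by (auto simp: S_def in_dcarrier)

lemmas S_simps = dualD[OF S_dual]

lemma component_add: "component (a + b) = component a + component b"
proof (rule component_unique)
  show "component a + component b \<in> L1"
    using component_mem ideals_subspace by (intro double.subspace_add)
  have "((a, 0) - component a) + ((b, 0) - component b) \<in> L2"
    using component_mem ideals_subspace by (intro double.subspace_add)
  also have "((a, 0) - component a) + ((b, 0) - component b) = (a + b, 0) - (component a + component b)"
    by (simp add: component_eq)
  finally show "(a + b, 0) - (component a + component b) \<in> L2" .
qed

lemma component_scale: "component (scale c a) = dscale c (component a)"
proof (rule component_unique)
  show "dscale c (component a) \<in> L1"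
    using component_mem ideals_subspace by (intro double.subspace_scale)
  have "dscale c ((a, 0) - component a) \<in> L2"
    using component_mem ideals_subspace by (intro double.subspace_scale)
  also have "dscale c ((a, 0) - component a) = (scale c a, 0) - dscale c (component a)"
    by (simp add: component_eq double_scale_def fun_scale_def fun_eq_iff scale_right_distrib)
  finally show "(scale c a, 0) - dscale c (component a) \<in> L2" .
qed

lemma R_linear: "Vector_Spaces.linear scale scale R"
  using component_add component_scale
  by (auto simp: Vector_Spaces.linear_iff vector_space_axioms R_def double_scale_def case_prod_unfold)

sublocale R: Vector_Spaces.linear scale scale R
  by (rule R_linear)

lemma S_add: "S (a + b) = S a + S b" and S_scale: "S (scale c a) = fun_scale c (S a)"
  using component_add component_scale by (auto simp: component_eq double_scale_def)

lemma S_bilinear: "bilinear_map scale (*) S"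
  by (rule bilinear_mapI)
    (auto simp: vector_space_axioms vector_space_field S_simps S_add S_scale fun_scale_def)

text \<open>If \<open>S a\<close> vanishes, both components of \<open>a\<close> lie in L, and each
  ideal meets L only in 0.\<close>

lemma S_eq_0: "S a = 0 \<Longrightarrow> a = 0"
  using component_mem[of a] base_trivial(1)[of "- R a"] base_trivial(2)[of "a + R a"]
  by (simp add: component_eq)

lemma S_surj:
  assumes f: "f \<in> dual scale"
  shows "\<exists>a. f = S a"
proof -
  \<comment> \<open>\<open>S\<close> is followed by the map sending a functional to the vector with
    coordinates \<open>f e\<close>. The composite is an endomorphism of L, so injectivity yields
    surjectivity by dimension.\<close>
  define T where "T a = (\<Sum>e\<in>Basis. scale (S a e) e)" for a
  have basis_eq: "g = h" if "g \<in> dual scale" "h \<in> dual scale" "\<And>e. e \<in> Basis \<Longrightarrow> g e = h e" for g h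
  proof
    interpret P: vector_space_pair scale "(*) :: 'f \<Rightarrow> 'f \<Rightarrow> 'f"
      by (simp add: vector_space_pair_def vector_space_axioms vector_space_field)
    show "g x = h x" for x
      by (rule P.linear_eq_on[of g h x Basis]) (use that in \<open>auto simp: dual_def span_Basis\<close>)
  qed
  have coeffs: "\<forall>e\<in>Basis. u e = v e"
    if "(\<Sum>e\<in>Basis. scale (u e) e) = (\<Sum>e\<in>Basis. scale (v e) e)" for u v
  proof -
    have "(\<Sum>e\<in>Basis. scale (u e - v e) e) = 0"
      using that by (simp add: scale_left_diff_distrib sum_subtractf)
    then show ?thesis
      using independentD[OF independent_Basis finite_Basis subset_refl, of "\<lambda>e. u e - v e"] by auto
  qed
  have lin: "Vector_Spaces.linear scale scale T"
    by (auto simp: Vector_Spaces.linear_iff vector_space_axioms T_def S_add S_scale fun_scale_def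
        scale_left_distrib sum.distrib scale_sum_right)
  moreover have "inj T"
  proof (rule injI)
    fix a b assume "T a = T b"
    then have "S a = S b"
      using coeffs[of "S a" "S b"] by (intro basis_eq S_dual) (auto simp: T_def)
    then have "S (a - b) = 0"
      using bilinear_mapD(9)[OF S_bilinear] by (simp add: fun_eq_iff)
    then show "a = b" using S_eq_0 by fastforce
  qed
  ultimately have "surj T" by (rule linear_inj_imp_surj)
  then obtain a where "(\<Sum>e\<in>Basis. scale (f e) e) = T a" by (metis surjD)
  then have "f = S a"
    using coeffs[of f "S a"] by (intro basis_eq S_dual f) (auto simp: T_def)
  then show ?thesis ..
qed

section \<open>Identification of \<open>R\<close> and \<open>S\<close> with the maps built from
  \<phi> and \<psi>\<close>

lemma phi_S: "phi L1 (S a) = R a" "phi L2 (S a) = a + R a"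
proof -
  have *: "phi I (S a) = b"
    if I: "double.subspace I" and b: "(- b, S a) \<in> I" and triv: "\<And>c. (c, 0) \<in> I \<Longrightarrow> c = 0" for I b
    unfolding phi_def
  proof (rule the_equality)
    show "(0, S a) - (b, 0) \<in> I" using b by simp
    fix c assume "(0, S a) - (c, 0) \<in> I"
    then have "((0, S a) - (c, 0)) - (- b, S a) \<in> I" using b by (rule double.subspace_diff[OF I])
    then show "c = b" using triv[of "b - c"] by simp
  qed
  show "phi L1 (S a) = R a"
    by (rule *) (use ideals_subspace component_mem(1)[of a] base_trivial in \<open>simp_all add: component_eq\<close>)
  \<comment> \<open>The second component of \<open>a\<close> is \<open>(a + R a, - S a)\<close>; its
    negative has the required shape.\<close>
  show "phi L2 (S a) = a + R a"
    by (rule *) (use ideals_subspace double.subspace_neg[OF ideals_subspace(2) component_mem(2)[of a]] base_trivial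
      in \<open>simp_all add: component_eq\<close>)
qed

lemma psi_eq: "psi scale L1 L2 a = S a"
  unfolding psi_def
proof (rule the_equality)
  show "S a \<in> dual scale \<and> a = - phi L1 (S a) + phi L2 (S a)"
    by (simp add: S_dual phi_S)
  fix f assume f: "f \<in> dual scale \<and> a = - phi L1 f + phi L2 f"
  then obtain b where "f = S b" using S_surj by blast
  then show "f = S a" using f by (simp add: phi_S)
qed

lemma phi_psi: "phi L1 (psi scale L1 L2 a) = R a"
  by (simp add: psi_eq phi_S)

text \<open>Multiplication by an element of L preserves both ideals, so it commutes with taking
  components. The functional part of this yields associativity of \<open>S\<close>; the L-part
  expresses the harpoon through \<open>R\<close>.\<close>

lemma component_mult_right: "component (br a c) = dmult (component a) (c, 0)"
proof (rule component_unique)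
  have c: "(c, 0) \<in> dcarrier" by (simp add: in_dcarrier zero_dual)
  show "dmult (component a) (c, 0) \<in> L1" by (rule ideals_mult(2)[OF c component_mem(1)])
  have "dmult ((a, 0) - component a) (c, 0) \<in> L2" by (rule ideals_mult(4)[OF c component_mem(2)])
  also have "dmult ((a, 0) - component a) (c, 0) = (br a c, 0) - dmult (component a) (c, 0)"
    using left_harpoon_diff[OF zero_dual S_dual, of a c] diff_dual[OF zero_dual S_dual, of a]
    by (simp add: component_eq dmult_right_base S_dual br_simps harpoon_zero fun_eq_iff)
  finally show "(br a c, 0) - dmult (component a) (c, 0) \<in> L2" .
qed

lemma component_mult_left: "component (br c a) = dmult (c, 0) (component a)"
proof (rule component_unique)
  have c: "(c, 0) \<in> dcarrier" by (simp add: in_dcarrier zero_dual)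
  show "dmult (c, 0) (component a) \<in> L1" by (rule ideals_mult(1)[OF c component_mem(1)])
  have "dmult (c, 0) ((a, 0) - component a) \<in> L2" by (rule ideals_mult(3)[OF c component_mem(2)])
  also have "dmult (c, 0) ((a, 0) - component a) = (br c a, 0) - dmult (c, 0) (component a)"
    using right_harpoon_diff[OF zero_dual S_dual, of c a] diff_dual[OF zero_dual S_dual, of a]
    by (simp add: component_eq dmult_left_base S_dual br_simps harpoon_zero fun_eq_iff)
  finally show "(br c a, 0) - dmult (c, 0) (component a) \<in> L2" .
qed

lemma S_br: "S (br a c) x = S a (br c x)"
  using component_mult_right[of a c] by (simp add: component_eq dmult_right_base S_dual)

lemma left_harpoon_S: "left_harpoon scale \<Delta> (S a) c = br (R a) c - R (br a c)"
  using component_mult_right[of a c]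
  by (simp add: component_eq dmult_right_base S_dual br_simps algebra_simps)

lemma right_harpoon_S: "right_harpoon scale \<Delta> c (S a) = br c (R a) - R (br c a)"
  using component_mult_left[of c a]
  by (simp add: component_eq dmult_left_base S_dual br_simps algebra_simps)

text \<open>The product of the first component of \<open>a\<close> with the second component of
  \<open>b\<close> lies in both ideals, so it is 0. Its L-part is the claim once the harpoons are
  expressed through \<open>R\<close>.\<close>

lemma rota_baxter: "br (R a) (R b) = R (br (R a) b + br a (R b) + br a b)"
proof -
  have "dmult (component a) ((b, 0) - component b) \<in> L1 \<inter> L2"
    using ideals_mult(2,3) component_mem ideals_carrier by blast
  then have "fst (dmult (component a) ((b, 0) - component b)) = 0"
    using inter by simp
  then have "br (- R a) (b + R b) + left_harpoon scale \<Delta> (S a) (b + R b)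
      + right_harpoon scale \<Delta> (- R a) (- S b) = 0"
    by (simp add: component_eq double_mult_def)
  moreover have "right_harpoon scale \<Delta> (- R a) (- S b) = - right_harpoon scale \<Delta> (- R a) (S b)"
    using right_harpoon_diff[OF zero_dual S_dual, of "- R a" b] by (simp add: harpoon_zero)
  ultimately show ?thesis
    by (simp add: left_harpoon_S right_harpoon_S br_simps R.add R.neg algebra_simps)
qed

text \<open>Orthogonality of the same two components gives
  \<open>S a b + S a (R b) + S b (R a) = 0\<close>. The last two terms together are symmetric in
  \<open>a\<close> and \<open>b\<close>, so \<open>S\<close> is symmetric, and the relation becomes
  adjointness.\<close>

lemma S_sym: "S a b = S b a" and R_adjoint: "S (R a) b + S a (R b) + S a b = 0"
proof -
  have *: "S a b + S a (R b) + S b (R a) = 0" for a b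
    using ideals_orthogonal[OF L1_simple L2_simple inter component_mem(1)[of a] component_mem(2)[of b]]
    by (simp add: pairing_def component_eq S_simps)
  show sym: "S a b = S b a" for a b
  proof -
    have "S a b + (S a (R b) + S b (R a)) = S b a + (S a (R b) + S b (R a))"
      using *[of a b] *[of b a] by (simp add: ac_simps)
    then show ?thesis by simp
  qed
  show "S (R a) b + S a (R b) + S a b = 0"
    using *[of a b] unfolding sym[of "R a" b] by (simp only: ac_simps)
qed

lemma rota_baxter_form:
  assumes "anticommutative UNIV br"
  shows "rota_baxter_form scale Basis br S R"
proof (intro rota_baxter_form.intro rota_baxter_form_axioms.intro)
  show "finite_dimensional_vector_space scale Basis" ..
  show "Vector_Spaces.linear scale scale R" by (rule R_linear)
  show "bilinear_map scale scale br" by (rule br_bilinear)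
  show "br x y = - br y x" for x y
    using assms unfolding anticommutative_def by blast
  show "bilinear_map scale (*) S" by (rule S_bilinear)
  show "S x y = S y x" for x y by (rule S_sym)
  show "S (br x y) z = S x (br y z)" for x y z by (rule S_br)
  show "x = 0" if "\<And>y. S x y = 0" for x
    using that by (intro S_eq_0) (simp add: fun_eq_iff)
  show "\<exists>x. f = S x" if "f \<in> dual scale" for f using that by (rule S_surj)
  show "br (R x) (R y) = R (br (R x) y + br x (R y) + br x y)" for x y by (rule rota_baxter)
  show "S (R x) y + S x (R y) + S x y = 0" for x y by (rule R_adjoint)
qed

end

section \<open>From the direct sum decomposition to the theorem\<close>

lemma internal_direct_sum_pair:
  assumes "internal_direct_sum {A, B} V" "A \<noteq> B" "0 \<in> A" "0 \<in> B"
  shows "v \<in> V \<Longrightarrow> \<exists>x\<in>A. v - x \<in> B"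
    and "(\<And>x. x \<in> B \<Longrightarrow> - x \<in> B) \<Longrightarrow> A \<inter> B = {0}"
proof -
  assume "v \<in> V"
  moreover have "V = {\<Sum>I\<in>{A, B}. c I | c. \<forall>I\<in>{A, B}. c I \<in> I}"
    using assms(1) unfolding internal_direct_sum_def by (rule conjunct1)
  ultimately obtain c where "v = (\<Sum>I\<in>{A, B}. c I)" "\<forall>I\<in>{A, B}. c I \<in> I" by blast
  \<comment> \<open>Distinctness of \<open>A\<close> and \<open>B\<close> makes the sum over the set
    have two terms.\<close>
  then have "v = c A + c B" "c A \<in> A" "c B \<in> B" using assms(2) by simp_all
  then show "\<exists>x\<in>A. v - x \<in> B" by (intro bexI[of _ "c A"]) auto
next
  assume neg: "\<And>x. x \<in> B \<Longrightarrow> - x \<in> B"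
  have "x = 0" if "x \<in> A" "x \<in> B" for x
  proof -
    \<comment> \<open>A common element \<open>x\<close> gives the relation x + (-x) = 0 between the
      two summands.\<close>
    let ?c = "\<lambda>I. if I = A then x else - x"
    have "(\<forall>I\<in>{A, B}. ?c I \<in> I) \<and> (\<Sum>I\<in>{A, B}. ?c I) = 0"
      using that neg assms(2) by auto
    moreover have "\<forall>c. (\<forall>I\<in>{A, B}. c I \<in> I) \<and> (\<Sum>I\<in>{A, B}. c I) = 0 \<longrightarrow> (\<forall>I\<in>{A, B}. c I = 0)"
      using assms(1) unfolding internal_direct_sum_def by (rule conjunct2)
    from spec[OF this, of ?c] calculation have "\<forall>I\<in>{A, B}. ?c I = 0" by (rule mp)
    then show ?thesis by simp
  qed
  then show "A \<inter> B = {0}" using assms by auto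
qed

theorem theorem3:
  fixes scale :: "'f::field_char_0 \<Rightarrow> 'v::ab_group_add \<Rightarrow> 'v"
    and br :: "'v \<Rightarrow> 'v \<Rightarrow> 'v"
    and \<Delta> :: "'v \<Rightarrow> ('f, 'v) tensor"
    and L1 L2 :: "('v \<times> ('v \<Rightarrow> 'f)) set"
    and R :: "'v \<Rightarrow> 'v"
  assumes "\<exists>B. finite_dimensional_vector_space scale B"
    and "bilinear_map scale scale br"
    and "anticommutative UNIV br"
    and "simple_algebra scale UNIV br"
    and "anticommutative_bialgebra scale br \<Delta>"
    and "semisimple_algebra (double_scale scale) (double_carrier scale) (double_mult scale br \<Delta>)"
    and "\<not> simple_algebra (double_scale scale) (double_carrier scale) (double_mult scale br \<Delta>)"
    and "simple_ideal (double_scale scale) (double_carrier scale) (double_mult scale br \<Delta>) L1"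
    and "simple_ideal (double_scale scale) (double_carrier scale) (double_mult scale br \<Delta>) L2"
    and "L1 \<noteq> L2"
    and "internal_direct_sum {L1, L2} (double_carrier scale)"
    and "\<And>a. R a = phi L1 (psi scale L1 L2 a)"
  shows "\<exists>ab \<omega>. let r = tensor_sum scale ab in
      cybe_solution scale br r \<and>
      tensor_switch scale r \<noteq> - r \<and>
      tensor_invariant scale br (r + tensor_switch scale r) \<and>
      bilinear_map scale (*) \<omega> \<and>
      nondegenerate_form \<omega> \<and> associative_form br \<omega> \<and> symmetric_form \<omega> \<and>
      (\<forall>a. R a = (\<Sum>(x, y)\<leftarrow>ab. scale (\<omega> x a) y))"
proof -
  obtain B where "finite_dimensional_vector_space scale B" using assms(1) ..
  then interpret finite_dimensional_vector_space scale B .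
  have comult: "comultiplication scale \<Delta>" using assms(5) by (simp add: anticommutative_bialgebra_def)
  interpret double_algebra scale B br \<Delta>
    by unfold_locales (fact assms(2) assms(4) comult)+
  have sub: "double.subspace L1" "double.subspace L2"
    using assms(8,9) by (auto simp: simple_ideal_def two_sided_ideal_def)
  note pair = internal_direct_sum_pair[OF assms(11,10) double.subspace_0[OF sub(1)] double.subspace_0[OF sub(2)]]
  interpret D: split_double scale B br \<Delta> L1 L2
    by unfold_locales (auto simp: assms(8,9) pair(1) pair(2)[OF double.subspace_neg[OF sub(2)]])
  interpret F: rota_baxter_form scale B br D.S D.R
    by (rule D.rota_baxter_form[OF assms(3)])
  have R: "R = D.R" using assms(12) D.phi_psi by auto
  \<comment> \<open>A nonzero product provides the nonzero vector that \<open>r_not_skew\<close>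
    requires.\<close>
  obtain x y where "br x y \<noteq> 0" using assms(4) by (auto simp: simple_algebra_def)
  show ?thesis
    unfolding Let_def R
  \<comment> \<open>The witnesses are the list \<open>F.r_pairs\<close> and the form
    \<open>D.S\<close>, that is, \<omega>(a, b) = \<psi>(a)(b).\<close>
  proof (intro exI conjI allI)
    show "cybe_solution scale br (tensor_sum scale F.r_pairs)" by (rule F.r_cybe)
    show "tensor_switch scale (tensor_sum scale F.r_pairs) \<noteq> - tensor_sum scale F.r_pairs"
      by (rule F.r_not_skew) fact
    show "tensor_invariant scale br
        (tensor_sum scale F.r_pairs + tensor_switch scale (tensor_sum scale F.r_pairs))"
      by (rule F.r_invariant)
    show "bilinear_map scale (*) D.S" by (rule D.S_bilinear)
    show "symmetric_form D.S" using D.S_sym by (simp add: symmetric_form_def)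
    then show "nondegenerate_form D.S"
      using F.form_nondeg unfolding nondegenerate_form_def symmetric_form_def by metis
    show "associative_form br D.S" by (simp add: associative_form_def D.S_br)
    show "D.R a = (\<Sum>(x, y)\<leftarrow>F.r_pairs. scale (D.S x a) y)" for a by (rule F.R_eq_r)
  qed
qed

end
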